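(* Let $G$ be a finitely generated group of automorphisms of a variety $X$. If $G$ is nilpotent, then for any $g_1, g_2 \in G$, we have $\mathrm{Per}^{*}(g_1) \subseteq \mathrm{Per}(g_2)$. In particular, if $\mathrm{Per}_n(g_1)$ and $\mathrm{Per}_n(g_2)$ are finite for all $n$, then $\mathrm{Per}(g_1) = \mathrm{Per}(g_2)$.
   Context: Varieties are defined over a field $K$ with algebraic closure $\overline{K}$ and are not assumed to be irreducible. For an automorphism $g: X \to X$ and a positive integer $n$, $\mathrm{Per}_n(g) = \{x \in X(\overline{K}) : g^n(x) = x\}$, a Zariski closed subset of $X$, and $\mathrm{Per}(g) = \bigcup_{n\ge 1} \mathrm{Per}_n(g)$. $\mathrm{Per}_n^*(g)$ is the set of points $x$ that are in $0$-dimensional components of $\mathrm{Per}_n(g)$ and for which $n$ is the smallest positive integer with $g^n(x) = x$; $\mathrm{Per}^*(g) = \bigcup_{n \ge 1} \mathrm{Per}_n^*(g)$. *)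

theory Defs
  imports
    "HOL-Analysis.Analysis"
    "HOL-Library.Poly_Mapping"
    "HOL-Algebra.Algebraic_Closure_Type"
    "HOL-Algebra.Generated_Groups"
    "HOL-Algebra.Bij"
begin

section \<open>Affine algebraic sets\<close>

text \<open>
  The ground field \<open>K\<close> is a type \<open>'k\<close> of class \<^class>\<open>field\<close>, and its algebraic closure is the
  type \<open>'k alg_closure\<close> with embedding \<open>to_ac\<close>. A polynomial over \<open>K\<close> is a finitely supported map
  from exponent vectors to coefficients.
\<close>

type_synonym 'k mpoly = "(nat \<Rightarrow>\<^sub>0 nat) \<Rightarrow>\<^sub>0 'k"

definition mpolys :: "nat \<Rightarrow> 'k::field mpoly set" where
  "mpolys n = {p. \<forall>m \<in> Poly_Mapping.keys p. Poly_Mapping.keys m \<subseteq> {..<n}}"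

definition peval :: "'k::field mpoly \<Rightarrow> (nat \<Rightarrow> 'k alg_closure) \<Rightarrow> 'k alg_closure" where
  "peval p x = (\<Sum>m \<in> Poly_Mapping.keys p. to_ac (Poly_Mapping.lookup p m) *
     (\<Prod>i \<in> Poly_Mapping.keys m. x i ^ Poly_Mapping.lookup m i))"

text \<open>Points of \<open>n\<close>-dimensional affine space are sequences that vanish from index \<open>n\<close> on.\<close>

definition zero_locus :: "nat \<Rightarrow> 'k::field mpoly set \<Rightarrow> (nat \<Rightarrow> 'k alg_closure) set" where
  "zero_locus n S = {x. (\<forall>i\<ge>n. x i = 0) \<and> (\<forall>p\<in>S. peval p x = 0)}"


section \<open>Varieties over \<open>K\<close>\<close>

text \<open>
  A variety over \<open>K\<close> (reduced and separated, of finite type, possibly reducible) is described as a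
  space with functions: the set of its geometric points, i.e. points over the algebraic closure,
  with the Zariski topology over \<open>K\<close> (locally cut out by polynomials with coefficients in
  \<open>K\<close>), and the sheaf assigning to an open set \<open>U\<close> the regular functions on \<open>U\<close> defined over
  \<open>K\<close>, seen as functions on geometric points. They are represented by members of
  \<^term>\<open>extensional U\<close>. The points need not be closed in this topology; the topology used for
  periodic points is \<open>zariski\<close> below.
\<close>

record (overloaded) ('p, 'k) fspace =
  ktop :: "'p topology"
  regular :: "'p set \<Rightarrow> ('p \<Rightarrow> 'k alg_closure) set"

abbreviation points :: "('p, 'k::field) fspace \<Rightarrow> 'p set" where
  "points \<X> \<equiv> topspace (ktop \<X>)"

definition function_sheaf :: "('p, 'k::field) fspace \<Rightarrow> bool" where
  "function_sheaf \<X> \<longleftrightarrow>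
     (\<forall>U. openin (ktop \<X>) U \<longrightarrow>
        regular \<X> U \<subseteq> extensional U \<and>
        (\<forall>c. (\<lambda>x\<in>U. to_ac c) \<in> regular \<X> U) \<and>
        (\<forall>s\<in>regular \<X> U. \<forall>t\<in>regular \<X> U.
           (\<lambda>x\<in>U. s x + t x) \<in> regular \<X> U \<and> (\<lambda>x\<in>U. s x * t x) \<in> regular \<X> U) \<and>
        (\<forall>s\<in>regular \<X> U. \<forall>W. openin (ktop \<X>) W \<and> W \<subseteq> U \<longrightarrow> restrict s W \<in> regular \<X> W) \<and>
        (\<forall>s\<in>extensional U.
           (\<forall>x\<in>U. \<exists>W. openin (ktop \<X>) W \<and> x \<in> W \<and> W \<subseteq> U \<and> restrict s W \<in> regular \<X> W)
           \<longrightarrow> s \<in> regular \<X> U))"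

definition morphism ::
  "('p, 'k::field) fspace \<Rightarrow> ('q, 'k) fspace \<Rightarrow> ('p \<Rightarrow> 'q) \<Rightarrow> bool" where
  "morphism \<X> \<Y> f \<longleftrightarrow> continuous_map (ktop \<X>) (ktop \<Y>) f \<and>
     (\<forall>V. openin (ktop \<Y>) V \<longrightarrow> (\<forall>s\<in>regular \<Y> V.
        restrict (s \<circ> f) {x \<in> points \<X>. f x \<in> V} \<in> regular \<X> {x \<in> points \<X>. f x \<in> V}))"

definition isomorphic :: "('p, 'k::field) fspace \<Rightarrow> ('q, 'k) fspace \<Rightarrow> bool" where
  "isomorphic \<X> \<Y> \<longleftrightarrow> (\<exists>f. bij_betw f (points \<X>) (points \<Y>) \<and>
     morphism \<X> \<Y> f \<and> morphism \<Y> \<X> (inv_into (points \<X>) f))"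

definition open_subspace :: "('p, 'k::field) fspace \<Rightarrow> 'p set \<Rightarrow> ('p, 'k) fspace" where
  "open_subspace \<X> U = \<lparr>ktop = subtopology (ktop \<X>) U, regular = regular \<X>\<rparr>"

text \<open>
  The closed subscheme of affine space cut out by \<open>S\<close>, with its reduced structure. In the
  definition of \<open>regular\<close>, the open neighbourhood of \<open>x\<close> on which \<open>s\<close> is a quotient of polynomials
  is a principal one, and it is defined over \<open>K\<close>: with neighbourhoods defined only over the
  algebraic closure, functions not defined over \<open>K\<close> would qualify.
\<close>

definition affine_fspace :: "nat \<Rightarrow> 'k::field mpoly set \<Rightarrow> (nat \<Rightarrow> 'k alg_closure, 'k) fspace" where
  "affine_fspace n S = \<lparr>
     ktop = topology_generated_by
       {{x \<in> zero_locus n S. peval q x \<noteq> 0} | q. q \<in> mpolys n},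
     regular = (\<lambda>U. {s \<in> extensional U. \<forall>x\<in>U. \<exists>p\<in>mpolys n. \<exists>q\<in>mpolys n. peval q x \<noteq> 0 \<and>
       (\<forall>y\<in>zero_locus n S. peval q y \<noteq> 0 \<longrightarrow> y \<in> U \<and> s y = peval p y / peval q y)})\<rparr>"

definition affine_variety :: "('p, 'k::field) fspace \<Rightarrow> bool" where
  "affine_variety \<X> \<longleftrightarrow> (\<exists>n S. S \<subseteq> mpolys n \<and> isomorphic \<X> (affine_fspace n S))"

text \<open>
  The Zariski topology of the product \<open>\<X> \<times> \<X>\<close> over \<open>K\<close>, which is finer than the product topology:
  the regular functions on a product of affine varieties are the sums of products
  \<open>f(x) h(y)\<close>.
\<close>

definition square_ktop :: "('p, 'k::field) fspace \<Rightarrow> ('p \<times> 'p) topology" where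
  "square_ktop \<X> = topology_generated_by
     {{(x, y). x \<in> U \<and> y \<in> V \<and> (\<Sum>i<r. f i x * h i y) \<noteq> 0} | U V (r::nat) f h.
       openin (ktop \<X>) U \<and> openin (ktop \<X>) V \<and>
       (\<forall>i<r. f i \<in> regular \<X> U \<and> h i \<in> regular \<X> V)}"

definition separated :: "('p, 'k::field) fspace \<Rightarrow> bool" where
  "separated \<X> \<longleftrightarrow> closedin (square_ktop \<X>) {(x, x) | x. x \<in> points \<X>}"

definition variety :: "('p, 'k::field) fspace \<Rightarrow> bool" where
  "variety \<X> \<longleftrightarrow> function_sheaf \<X> \<and> separated \<X> \<and>
     (\<exists>\<U>. finite \<U> \<and> \<Union>\<U> = points \<X> \<and>
        (\<forall>U\<in>\<U>. openin (ktop \<X>) U \<and> affine_variety (open_subspace \<X> U)))"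

text \<open>
  The geometric Zariski topology, i.e. that of the base change of \<open>\<X>\<close> to the algebraic closure:
  on affine pieces the closed sets are cut out by polynomials with coefficients in the closure.
  It is generated by the non-vanishing loci of linear combinations, over the closure, of regular
  functions defined over \<open>K\<close>.
\<close>

definition zariski :: "('p, 'k::field) fspace \<Rightarrow> 'p topology" where
  "zariski \<X> = topology_generated_by
     {{x \<in> U. (\<Sum>i<r. c i * f i x) \<noteq> 0} | U (r::nat) c f.
       openin (ktop \<X>) U \<and> (\<forall>i<r. f i \<in> regular \<X> U)}"

definition automorphism :: "('p, 'k::field) fspace \<Rightarrow> ('p \<Rightarrow> 'p) \<Rightarrow> bool" where
  "automorphism \<X> g \<longleftrightarrow> bij_betw g (points \<X>) (points \<X>) \<and>
     morphism \<X> \<X> g \<and> morphism \<X> \<X> (inv_into (points \<X>) g)"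

definition aut_group :: "('p, 'k::field) fspace \<Rightarrow> ('p \<Rightarrow> 'p) monoid" where
  "aut_group \<X> = (BijGroup (points \<X>))\<lparr>carrier := {g \<in> Bij (points \<X>). automorphism \<X> g}\<rparr>"


section \<open>Irreducible components and dimension\<close>

definition irreducible_space :: "'a topology \<Rightarrow> bool" where
  "irreducible_space T \<longleftrightarrow> topspace T \<noteq> {} \<and>
     (\<forall>A B. closedin T A \<and> closedin T B \<and> A \<union> B = topspace T \<longrightarrow>
        A = topspace T \<or> B = topspace T)"

definition irreducible_in :: "'a topology \<Rightarrow> 'a set \<Rightarrow> bool" where
  "irreducible_in T Z \<longleftrightarrow> Z \<subseteq> topspace T \<and> irreducible_space (subtopology T Z)"

definition irreducible_component :: "'a topology \<Rightarrow> 'a set \<Rightarrow> bool" where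
  "irreducible_component T Z \<longleftrightarrow> irreducible_in T Z \<and>
     (\<forall>Z'. irreducible_in T Z' \<and> Z \<subseteq> Z' \<longrightarrow> Z' = Z)"

text \<open>The empty space, whose dimension is not used, gets dimension \<open>0\<close> here.\<close>

definition krull_dim :: "'a topology \<Rightarrow> enat" where
  "krull_dim T = Sup {enat n | n. \<exists>Z.
     (\<forall>i\<le>n. closedin T (Z i) \<and> irreducible_in T (Z i)) \<and> (\<forall>i<n. Z i \<subset> Z (Suc i))}"


section \<open>Periodic points\<close>

definition Per_n :: "('p, 'k::field) fspace \<Rightarrow> nat \<Rightarrow> ('p \<Rightarrow> 'p) \<Rightarrow> 'p set" where
  "Per_n \<X> n g = {x \<in> points \<X>. (g ^^ n) x = x}"

definition Per :: "('p, 'k::field) fspace \<Rightarrow> ('p \<Rightarrow> 'p) \<Rightarrow> 'p set" where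
  "Per \<X> g = (\<Union>n\<in>{1..}. Per_n \<X> n g)"

definition Per_n_star :: "('p, 'k::field) fspace \<Rightarrow> nat \<Rightarrow> ('p \<Rightarrow> 'p) \<Rightarrow> 'p set" where
  "Per_n_star \<X> n g = {x \<in> Per_n \<X> n g.
     (\<exists>Z. irreducible_component (subtopology (zariski \<X>) (Per_n \<X> n g)) Z \<and>
          krull_dim (subtopology (zariski \<X>) Z) = 0 \<and> x \<in> Z) \<and>
     (\<forall>m. 0 < m \<and> m < n \<longrightarrow> (g ^^ m) x \<noteq> x)}"

definition Per_star :: "('p, 'k::field) fspace \<Rightarrow> ('p \<Rightarrow> 'p) \<Rightarrow> 'p set" where
  "Per_star \<X> g = (\<Union>n\<in>{1..}. Per_n_star \<X> n g)"


section \<open>Finitely generated and nilpotent groups\<close>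

definition finitely_generated_group :: "('a, 'b) monoid_scheme \<Rightarrow> bool" where
  "finitely_generated_group G \<longleftrightarrow>
     Group.group G \<and> (\<exists>A. finite A \<and> A \<subseteq> carrier G \<and> generate G A = carrier G)"

fun lower_central :: "('a, 'b) monoid_scheme \<Rightarrow> nat \<Rightarrow> 'a set" where
  "lower_central G 0 = carrier G"
| "lower_central G (Suc n) = generate G
     {a \<otimes>\<^bsub>G\<^esub> b \<otimes>\<^bsub>G\<^esub> inv\<^bsub>G\<^esub> a \<otimes>\<^bsub>G\<^esub> inv\<^bsub>G\<^esub> b | a b. a \<in> carrier G \<and> b \<in> lower_central G n}"

definition nilpotent_group :: "('a, 'b) monoid_scheme \<Rightarrow> bool" where
  "nilpotent_group G \<longleftrightarrow> Group.group G \<and> (\<exists>n. lower_central G n = {\<one>\<^bsub>G\<^esub>})"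

end

theory Submission
  imports Defs "HOL-Library.Function_Algebras" "HOL-Algebra.Group_Action"
begin

text \<open>
  Let \<open>x\<close> lie in a zero-dimensional component of \<open>Per_n(g\<^sub>1)\<close>, and put \<open>h = g\<^sub>1\<^sup>n\<close>, so that
  \<open>Per_n(g\<^sub>1)\<close> is the set of fixed points of \<open>h\<close>. The heart of the proof is that the whole orbit
  \<open>Gx\<close> is finite (\<open>nilpotent_finite_orbit\<close>). The points \<open>g\<^sub>2\<^sup>k x\<close> then cannot all be distinct, and
  since \<open>g\<^sub>2\<close> is injective, \<open>x\<close> is periodic under \<open>g\<^sub>2\<close>.

  The geometric input is that the geometric Zariski topology is Noetherian
  (\<open>noetherian_zariski\<close>) and its points are closed (\<open>t1_zariski\<close>). Closed points make a
  zero-dimensional component a singleton, and a Noetherian space has only finitely many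
  irreducible components. So for every set \<open>Y\<close> of points the set \<open>D(Y)\<close> of those \<open>x\<close> for which
  \<open>{x}\<close> is a component of \<open>Y\<close> is finite. Moreover \<open>x \<in> D(Y)\<close> implies \<open>x \<in> D(Y')\<close> whenever
  \<open>x \<in> Y' \<subseteq> Y\<close>, and automorphisms carry \<open>D(Y)\<close> to \<open>D(gY)\<close>. The Noetherian property comes
  from Hilbert's basis theorem for polynomial functions over the algebraic closure.

  For the finiteness of \<open>Gx\<close>, suppose that a finitely generated subgroup \<open>H\<close> contains \<open>h\<close>, that
  \<open>Hx\<close> is finite and that \<open>a\<close> normalizes \<open>H\<close> (\<open>finite_orbit_insert_normalizing\<close>). All the points
  \<open>a\<^sup>k x\<close> have \<open>H\<close>-orbits of the same size, and a finitely generated group has only finitely many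
  subgroups of a given finite index, so only finitely many subgroups \<open>S\<close> of \<open>H\<close> occur as stabilizers
  of points \<open>a\<^sup>k x\<close>. Translating \<open>x \<in> D(Fix(Stab_H(x)))\<close> by \<open>a\<^sup>k\<close> puts each \<open>a\<^sup>k x\<close> into one of
  the finitely many finite sets \<open>D(Fix(S))\<close>. Hence \<open>x\<close> is periodic under \<open>a\<close>, and its orbit
  under the group generated by \<open>H\<close> and \<open>a\<close> is finite.

  One starts with the group generated by \<open>h\<close>, which fixes \<open>x\<close>, and climbs up the lower central
  series, whose terms are finitely generated (\<open>lower_central_fg\<close>). A generator \<open>a\<close> of one term
  normalizes every subgroup \<open>H\<close> containing the next term, because \<open>a y a\<^sup>-\<^sup>1 = [a, y] y\<close> and the
  commutator \<open>[a, y]\<close> lies in the next term.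

  If all \<open>Per_n(g)\<close> are finite, they are discrete, so every periodic point of \<open>g\<close> lies in
  \<open>Per\<^sup>*(g)\<close>; applying the first part in both directions gives the equality.
\<close>

section \<open>Hilbert's basis theorem for polynomial functions\<close>

text \<open>
  Commutative algebra takes place in subrings \<open>R\<close> of one fixed type, since the number of variables
  varies and the rings of polynomial functions in \<open>n\<close> variables are all subrings of the same ring of
  functions.
\<close>

inductive_set ideal_span :: "'a::comm_ring_1 set \<Rightarrow> 'a set \<Rightarrow> 'a set" for R A where
  zero: "0 \<in> ideal_span R A"
| step: "r \<in> R \<Longrightarrow> a \<in> A \<Longrightarrow> y \<in> ideal_span R A \<Longrightarrow> r * a + y \<in> ideal_span R A"

text \<open>
  The generating set is found inside the given set \<open>A\<close> itself, not merely inside the ideal that it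
  generates: this form yields finite subcovers directly.
\<close>

definition noetherian_in :: "'a::comm_ring_1 set \<Rightarrow> bool" where
  "noetherian_in R \<longleftrightarrow> (\<forall>A\<subseteq>R. \<exists>B\<subseteq>A. finite B \<and> A \<subseteq> ideal_span R B)"

lemma ideal_span_add:
  "x \<in> ideal_span R A \<Longrightarrow> y \<in> ideal_span R A \<Longrightarrow> x + y \<in> ideal_span R A"
  by (induction rule: ideal_span.induct) (auto simp: add.assoc intro: ideal_span.step)

lemma ideal_span_mono: "A \<subseteq> B \<Longrightarrow> ideal_span R A \<subseteq> ideal_span R B"
proof
  fix x assume "x \<in> ideal_span R A" and "A \<subseteq> B"
  then show "x \<in> ideal_span R B"
    by (induction rule: ideal_span.induct) (auto intro: ideal_span.intros)
qed

lemma ideal_span_finite_support: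
  "x \<in> ideal_span R A \<Longrightarrow> \<exists>B\<subseteq>A. finite B \<and> x \<in> ideal_span R B"
proof (induction rule: ideal_span.induct)
  case zero
  then show ?case by (auto intro: ideal_span.zero)
next
  case (step r a y)
  then obtain B where "B \<subseteq> A" "finite B" "y \<in> ideal_span R B" by blast
  then have "insert a B \<subseteq> A" "finite (insert a B)" "r * a + y \<in> ideal_span R (insert a B)"
    using step ideal_span_mono[of B "insert a B" R] by (auto intro: ideal_span.step)
  then show ?case by blast
qed

locale subring_set =
  fixes R :: "'a::comm_ring_1 set"
  assumes one_closed: "1 \<in> R"
    and add_closed: "x \<in> R \<Longrightarrow> y \<in> R \<Longrightarrow> x + y \<in> R"
    and mult_closed: "x \<in> R \<Longrightarrow> y \<in> R \<Longrightarrow> x * y \<in> R"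
    and uminus_closed: "x \<in> R \<Longrightarrow> - x \<in> R"
begin

lemma zero_closed: "0 \<in> R"
  using add_closed[OF one_closed uminus_closed[OF one_closed]] by simp

lemma sum_closed: "(\<And>i. i \<in> I \<Longrightarrow> f i \<in> R) \<Longrightarrow> sum f I \<in> R"
  by (induction I rule: infinite_finite_induct) (auto intro: zero_closed add_closed)

lemma ideal_span_base: "a \<in> A \<Longrightarrow> a \<in> ideal_span R A"
  using ideal_span.step[OF one_closed _ ideal_span.zero, of a] by simp

lemma ideal_span_mult: "x \<in> ideal_span R A \<Longrightarrow> r \<in> R \<Longrightarrow> r * x \<in> ideal_span R A"
proof (induction rule: ideal_span.induct)
  case (step s a y)
  have "r * (s * a + y) = (r * s) * a + r * y" by (simp add: algebra_simps)
  then show ?case using step by (auto intro: ideal_span.step mult_closed)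
qed (auto intro: ideal_span.zero)

lemma ideal_span_diff:
  assumes "x \<in> ideal_span R A" "y \<in> ideal_span R A"
  shows "x - y \<in> ideal_span R A"
  using ideal_span_add[OF assms(1) ideal_span_mult[OF assms(2) uminus_closed[OF one_closed]]]
  by simp

lemma ideal_span_subset_ideal_span: "A \<subseteq> ideal_span R B \<Longrightarrow> ideal_span R A \<subseteq> ideal_span R B"
proof
  fix x assume "x \<in> ideal_span R A" "A \<subseteq> ideal_span R B"
  then show "x \<in> ideal_span R B"
    by (induction rule: ideal_span.induct)
       (auto intro: ideal_span.zero ideal_span_add ideal_span_mult)
qed

lemma ideal_span_closed: "x \<in> ideal_span R A \<Longrightarrow> A \<subseteq> R \<Longrightarrow> x \<in> R"
  by (induction rule: ideal_span.induct) (auto intro: zero_closed add_closed mult_closed)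

lemma ideal_span_finite_supports:
  assumes "finite C" "C \<subseteq> ideal_span R A"
  shows "\<exists>B\<subseteq>A. finite B \<and> C \<subseteq> ideal_span R B"
  using assms
proof (induction C)
  case (insert c C)
  then obtain B where B: "B \<subseteq> A" "finite B" "C \<subseteq> ideal_span R B" by auto
  obtain B' where B': "B' \<subseteq> A" "finite B'" "c \<in> ideal_span R B'"
    using ideal_span_finite_support insert.prems by (metis insert_subset)
  have "insert c C \<subseteq> ideal_span R (B \<union> B')"
    using B B' ideal_span_mono[of B "B \<union> B'" R] ideal_span_mono[of B' "B \<union> B'" R] by auto
  then show ?case using B B' by (intro exI[of _ "B \<union> B'"]) auto
qed auto

end

definition polys_over :: "'a::comm_ring_1 set \<Rightarrow> 'a poly set" where
  "polys_over R = {p. \<forall>i. Polynomial.coeff p i \<in> R}"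

context subring_set
begin

lemma monom_in_polys_over: "r \<in> R \<Longrightarrow> Polynomial.monom r n \<in> polys_over R"
  by (auto simp: polys_over_def zero_closed)

lemma subring_polys_over: "subring_set (polys_over R)"
proof
  show "1 \<in> polys_over R"
    using monom_in_polys_over[OF one_closed, of 0] by (simp add: monom_0 one_pCons)
  fix p q assume pq: "p \<in> polys_over R" "q \<in> polys_over R"
  show "p + q \<in> polys_over R" using pq by (auto simp: polys_over_def add_closed)
  show "p * q \<in> polys_over R"
    using pq by (auto simp: polys_over_def coeff_mult intro!: sum_closed mult_closed)
  show "- p \<in> polys_over R" using pq by (auto simp: polys_over_def uminus_closed)
qed

text \<open>
  Hilbert's argument: from an ideal that is not finitely generated, choose polynomials
  \<open>g 0, g 1, \<dots>\<close>, each of minimal degree outside the ideal generated by its predecessors. The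
  leading coefficient of some \<open>g N\<close> is a combination of earlier leading coefficients. Subtracting
  the same combination of the earlier polynomials, shifted to the degree of \<open>g N\<close>, cancels the
  leading term but stays outside the ideal generated by the predecessors, against minimality.
\<close>

theorem hilbert_basis:
  assumes R: "noetherian_in R"
  shows "noetherian_in (polys_over R)"
proof (rule ccontr)
  interpret P: subring_set "polys_over R" by (rule subring_polys_over)
  let ?span = "ideal_span (polys_over R)"
  assume "\<not> noetherian_in (polys_over R)"
  then have "\<exists>A\<subseteq>polys_over R. \<forall>B\<subseteq>A. finite B \<longrightarrow> \<not> A \<subseteq> ?span B"
    by (simp only: noetherian_in_def not_all not_ex not_imp de_Morgan_conj) metis
  then obtain A where A: "A \<subseteq> polys_over R"
    and *: "\<forall>B\<subseteq>A. finite B \<longrightarrow> \<not> A \<subseteq> ?span B"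
    by (elim exE conjE)
  have notfin: "\<not> A \<subseteq> ?span B" if "B \<subseteq> A" "finite B" for B
    using *[rule_format, OF that] .
  define I where "I = ?span A"
  have I_not_fg: "\<not> I \<subseteq> ?span C" if "finite C" "C \<subseteq> I" for C
  proof
    assume "I \<subseteq> ?span C"
    from P.ideal_span_finite_supports[OF that(1) that(2)[unfolded I_def]]
    obtain B where B: "B \<subseteq> A" "finite B" "C \<subseteq> ?span B"
      by (elim exE conjE)
    have "A \<subseteq> I" unfolding I_def using P.ideal_span_base by blast
    also have "\<dots> \<subseteq> ?span C" by fact
    also have "\<dots> \<subseteq> ?span B" using B(3) by (rule P.ideal_span_subset_ideal_span)
    finally show False using notfin[OF B(1,2)] by contradiction
  qed
  define minimal where "minimal g n r \<longleftrightarrow> r \<in> I - ?span (g ` {..<n}) \<and>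
      (\<forall>p\<in>I - ?span (g ` {..<n}). Polynomial.degree r \<le> Polynomial.degree p)"
    for g :: "nat \<Rightarrow> 'a poly" and n r
  \<comment> \<open>The choice of \<open>g n\<close> depends on all earlier choices, hence well-founded dependent choice.\<close>
  have "\<exists>g. \<forall>n. minimal g n (g n)"
  proof (rule dependent_wellorder_choice)
    fix r and f g :: "nat \<Rightarrow> 'a poly" and n assume "\<And>y. y < n \<Longrightarrow> f y = g y"
    then have "f ` {..<n} = g ` {..<n}" by (intro image_cong) auto
    then show "minimal f n r = minimal g n r" by (simp add: minimal_def)
  next
    fix n and f :: "nat \<Rightarrow> 'a poly" assume "\<And>y. y < n \<Longrightarrow> minimal f y (f y)"
    then have "f ` {..<n} \<subseteq> I" by (auto simp: minimal_def)
    then obtain p where "p \<in> I - ?span (f ` {..<n})" using I_not_fg[of "f ` {..<n}"] by auto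
    from ex_has_least_nat[of "\<lambda>p. p \<in> I - ?span (f ` {..<n})", OF this, of Polynomial.degree]
    show "\<exists>r. minimal f n r" unfolding minimal_def by blast
  qed
  then obtain g where g: "\<And>n. minimal g n (g n)" by blast
  have gI: "g n \<in> I" for n using g[of n] by (simp add: minimal_def)
  have gR: "g n \<in> polys_over R" for n
    using gI[of n] P.ideal_span_closed A unfolding I_def by blast
  have degree_mono: "Polynomial.degree (g j) \<le> Polynomial.degree (g n)" if "j \<le> n" for j n
  proof -
    have "?span (g ` {..<j}) \<subseteq> ?span (g ` {..<n})" using that by (intro ideal_span_mono) auto
    then have "g n \<in> I - ?span (g ` {..<j})" using g[of n] by (auto simp: minimal_def)
    then show ?thesis using g[of j] by (simp add: minimal_def)
  qed
  define lc where "lc n = Polynomial.lead_coeff (g n)" for n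
  have "range lc \<subseteq> R" using gR by (auto simp: lc_def polys_over_def)
  from R[unfolded noetherian_in_def, rule_format, OF this]
  obtain B where B: "B \<subseteq> range lc" "finite B" "range lc \<subseteq> ideal_span R B"
    by (elim exE conjE)
  obtain J where J: "finite J" "B = lc ` J" using B(1,2) by (meson finite_subset_image)
  obtain N where N: "J \<subseteq> {..<N}" using J(1) finite_nat_iff_bounded by blast
  have "lc N \<in> ideal_span R (lc ` {..<N})"
    using B(3) ideal_span_mono[of B "lc ` {..<N}" R] J N by auto
  define d where "d = Polynomial.degree (g N)"
  have "\<exists>q\<in>?span (g ` {..<N}). Polynomial.degree q \<le> d \<and> Polynomial.coeff q d = c"
    if "c \<in> ideal_span R (lc ` {..<N})" for c
    using that
  proof (induction rule: ideal_span.induct)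
    case zero
    then show ?case by (intro bexI[of _ 0]) (auto intro: ideal_span.zero)
  next
    case (step r a y)
    then obtain q where q: "q \<in> ?span (g ` {..<N})" "Polynomial.degree q \<le> d"
      "Polynomial.coeff q d = y" by blast
    obtain j where j: "j < N" "a = lc j" using step by auto
    define e where "e = d - Polynomial.degree (g j)"
    have e: "e + Polynomial.degree (g j) = d" using degree_mono[of j N] j by (simp add: e_def d_def)
    define q' where "q' = Polynomial.monom r e * g j + q"
    have "Polynomial.degree (Polynomial.monom r e * g j) \<le> d"
      using degree_mult_le[of "Polynomial.monom r e" "g j"] degree_monom_le[of r e] e by linarith
    then have "Polynomial.degree q' \<le> d" unfolding q'_def using q(2) by (rule degree_add_le)
    moreover have "Polynomial.coeff q' d = r * a + y"
      using q(3) e j(2) by (auto simp: q'_def coeff_monom_mult lc_def)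
    moreover have "q' \<in> ?span (g ` {..<N})" unfolding q'_def
      using j(1) q(1) step(1) by (intro ideal_span.step monom_in_polys_over) auto
    ultimately show ?case by blast
  qed
  then obtain q where q: "q \<in> ?span (g ` {..<N})" "Polynomial.degree q \<le> d"
      "Polynomial.coeff q d = lc N" using \<open>lc N \<in> _\<close> by blast
  define p where "p = g N - q"
  have "q \<in> I" using q(1) P.ideal_span_subset_ideal_span[of "g ` {..<N}" A] gI
    unfolding I_def by blast
  then have "p \<in> I" unfolding p_def I_def using gI[of N] P.ideal_span_diff I_def by blast
  moreover have p_notin: "p \<notin> ?span (g ` {..<N})"
  proof
    assume "p \<in> ?span (g ` {..<N})"
    then have "p + q \<in> ?span (g ` {..<N})" using q(1) by (rule ideal_span_add)
    then show False using g[of N] by (simp add: p_def minimal_def)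
  qed
  ultimately have "d \<le> Polynomial.degree p" using g[of N] by (auto simp: minimal_def d_def)
  moreover have "Polynomial.degree p \<le> d"
    unfolding p_def using q(2) by (intro degree_diff_le) (auto simp: d_def)
  \<comment> \<open>The degree of \<open>p\<close> is exactly \<open>d\<close>, but its coefficient there has been cancelled.\<close>
  ultimately have "Polynomial.lead_coeff p = 0"
    using q(3) by (simp add: p_def lc_def d_def)
  then have "p = 0" by simp
  then show False using p_notin ideal_span.zero by metis
qed

end

lemma noetherian_in_hom_image:
  fixes f :: "'a::comm_ring_1 \<Rightarrow> 'b::comm_ring_1"
  assumes P: "noetherian_in P"
    and zero: "f 0 = 0"
    and add: "\<And>x y. f (x + y) = f x + f y"
    and mult: "\<And>x y. f (x * y) = f x * f y"
  shows "noetherian_in (f ` P)"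
  unfolding noetherian_in_def
proof (intro allI impI)
  fix A assume A: "A \<subseteq> f ` P"
  obtain B where B: "B \<subseteq> {p \<in> P. f p \<in> A}" "finite B" "{p \<in> P. f p \<in> A} \<subseteq> ideal_span P B"
    using P[unfolded noetherian_in_def, rule_format, of "{p \<in> P. f p \<in> A}"] by blast
  have span: "f x \<in> ideal_span (f ` P) (f ` B)" if "x \<in> ideal_span P B" for x
    using that
    by (induction rule: ideal_span.induct)
       (auto simp: zero add mult intro: ideal_span.zero ideal_span.step)
  have "A \<subseteq> ideal_span (f ` P) (f ` B)"
  proof
    fix a assume "a \<in> A"
    then obtain p where "p \<in> P" "a = f p" using A by blast
    then show "a \<in> ideal_span (f ` P) (f ` B)" using span B(3) \<open>a \<in> A\<close> by auto
  qed
  then show "\<exists>B\<subseteq>A. finite B \<and> A \<subseteq> ideal_span (f ` P) B"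
    using B by (intro exI[of _ "f ` B"]) auto
qed

text \<open>
  Polynomials in \<open>n\<close> variables over a field, as functions on sequences of which only the first \<open>n\<close>
  entries matter. The recursion adjoins one coordinate at a time, so that the basis theorem
  applies at each step; evaluating formal polynomials at the coordinate function avoids
  multivariate polynomials.
\<close>

primrec polynomial_functions :: "nat \<Rightarrow> ((nat \<Rightarrow> 'a::field) \<Rightarrow> 'a) set" where
  "polynomial_functions 0 = range (\<lambda>c x. c)"
| "polynomial_functions (Suc n) =
     (\<lambda>p. poly p (\<lambda>x. x n)) ` polys_over (polynomial_functions n)"

lemma noetherian_constant_functions: "noetherian_in (range (\<lambda>c (x::'b). c :: 'a::field))"
  unfolding noetherian_in_def
proof (intro allI impI)
  fix A :: "('b \<Rightarrow> 'a) set" assume A: "A \<subseteq> range (\<lambda>c x. c)"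
  let ?R = "range (\<lambda>c (x::'b). c :: 'a)"
  show "\<exists>B\<subseteq>A. finite B \<and> A \<subseteq> ideal_span ?R B"
  proof (cases "A \<subseteq> {0}")
    case True
    then show ?thesis by (intro exI[of _ "{}"]) (auto intro: ideal_span.zero)
  next
    case False
    then obtain a where a: "(\<lambda>x. a) \<in> A" "a \<noteq> 0" using A by (auto simp: zero_fun_def)
    have "A \<subseteq> ideal_span ?R {\<lambda>x. a}"
    proof
      fix f assume "f \<in> A"
      then obtain c where c: "f = (\<lambda>x. c)" using A by blast
      have "(\<lambda>x. c / a) * (\<lambda>x. a) + 0 \<in> ideal_span ?R {\<lambda>x. a}"
        by (intro ideal_span.intros) auto
      moreover have "(\<lambda>x. c / a) * (\<lambda>x. a) + 0 = f"
        using a(2) c by (auto simp: fun_eq_iff)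
      ultimately show "f \<in> ideal_span ?R {\<lambda>x. a}" by metis
    qed
    then show ?thesis using a by (intro exI[of _ "{\<lambda>x. a}"]) auto
  qed
qed

lemma polynomial_functions_subring_noetherian:
  "subring_set (polynomial_functions n :: ((nat \<Rightarrow> 'a::field) \<Rightarrow> 'a) set) \<and>
   noetherian_in (polynomial_functions n :: ((nat \<Rightarrow> 'a) \<Rightarrow> 'a) set)"
proof (induction n)
  case 0
  have "subring_set (range (\<lambda>c (x::nat \<Rightarrow> 'a). c :: 'a))"
    by unfold_locales (auto simp: one_fun_def plus_fun_def times_fun_def fun_Compl_def)
  then show ?case by (simp add: noetherian_constant_functions)
next
  case (Suc n)
  let ?R = "polynomial_functions n :: ((nat \<Rightarrow> 'a) \<Rightarrow> 'a) set"
  let ?t = "\<lambda>x::nat \<Rightarrow> 'a. x n"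
  interpret R: subring_set ?R using Suc by simp
  interpret P: subring_set "polys_over ?R" by (rule R.subring_polys_over)
  have "noetherian_in ((\<lambda>p. poly p ?t) ` polys_over ?R)"
    using Suc by (intro noetherian_in_hom_image R.hilbert_basis) auto
  moreover have "subring_set ((\<lambda>p. poly p ?t) ` polys_over ?R)"
  proof
    show "1 \<in> (\<lambda>p. poly p ?t) ` polys_over ?R" using P.one_closed by (rule rev_image_eqI) simp
    fix f g assume "f \<in> (\<lambda>p. poly p ?t) ` polys_over ?R" "g \<in> (\<lambda>p. poly p ?t) ` polys_over ?R"
    then obtain p q where pq: "p \<in> polys_over ?R" "q \<in> polys_over ?R"
      "f = poly p ?t" "g = poly q ?t" by blast
    show "f + g \<in> (\<lambda>p. poly p ?t) ` polys_over ?R"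
      using P.add_closed[OF pq(1,2)] pq(3,4) by (intro rev_image_eqI[of "p + q"]) auto
    show "f * g \<in> (\<lambda>p. poly p ?t) ` polys_over ?R"
      using P.mult_closed[OF pq(1,2)] pq(3,4) by (intro rev_image_eqI[of "p * q"]) auto
    show "- f \<in> (\<lambda>p. poly p ?t) ` polys_over ?R"
      using P.uminus_closed[OF pq(1)] pq(3) by (intro rev_image_eqI[of "- p"]) auto
  qed
  ultimately show ?case by simp
qed

lemma polynomial_functions_Suc: "f \<in> polynomial_functions n \<Longrightarrow> f \<in> polynomial_functions (Suc n)"
proof -
  assume f: "f \<in> polynomial_functions n"
  interpret R: subring_set "polynomial_functions n :: ((nat \<Rightarrow> 'a) \<Rightarrow> 'a) set"
    using polynomial_functions_subring_noetherian by blast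
  show ?thesis
    using R.monom_in_polys_over[OF f, of 0]
    by (auto simp: poly_monom intro!: rev_image_eqI[of "Polynomial.monom f 0"])
qed

lemma const_in_polynomial_functions: "(\<lambda>x. c) \<in> polynomial_functions n"
  by (induction n) (simp, rule polynomial_functions_Suc)

lemma coordinate_in_polynomial_functions:
  "i < n \<Longrightarrow> (\<lambda>x::nat \<Rightarrow> 'a::field. x i) \<in> polynomial_functions n"
proof (induction n)
  case (Suc n)
  interpret R: subring_set "polynomial_functions n :: ((nat \<Rightarrow> 'a) \<Rightarrow> 'a) set"
    using polynomial_functions_subring_noetherian by blast
  show ?case
  proof (cases "i = n")
    case True
    then show ?thesis
      using R.monom_in_polys_over[OF R.one_closed, of 1]
      by (auto simp: poly_monom intro!: rev_image_eqI[of "Polynomial.monom 1 1"])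
  next
    case False
    then show ?thesis using Suc by (intro polynomial_functions_Suc) simp_all
  qed
qed simp

section \<open>Noetherian spaces and irreducible components\<close>

text \<open>
  Compactness of all subsets is equivalent to the descending chain condition on closed sets, and
  it passes without effort to images, subspaces and finite unions.
\<close>

definition noetherian_space :: "'a topology \<Rightarrow> bool" where
  "noetherian_space T \<longleftrightarrow> (\<forall>S\<subseteq>topspace T. compactin T S)"

lemma noetherian_space_subtopology:
  "noetherian_space T \<Longrightarrow> noetherian_space (subtopology T Y)"
  by (auto simp: noetherian_space_def compactin_subtopology)

lemma compactin_continuous_image_noetherian:
  assumes "noetherian_space T" "continuous_map T T' f" "S \<subseteq> f ` topspace T"
  shows "compactin T' S"
proof -
  have "S = f ` {x \<in> topspace T. f x \<in> S}" using assms(3) by auto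
  moreover have "compactin T {x \<in> topspace T. f x \<in> S}"
    using assms(1) unfolding noetherian_space_def by auto
  ultimately show ?thesis using image_compactin[OF _ assms(2)] by metis
qed

lemma noetherian_space_wf_closedin:
  assumes "noetherian_space T"
  shows "wf {(A, B). closedin T A \<and> closedin T B \<and> A \<subset> B}"
  unfolding wf_iff_no_infinite_down_chain
proof
  assume "\<exists>A. \<forall>i. (A (Suc i), A i) \<in> {(A, B). closedin T A \<and> closedin T B \<and> A \<subset> B}"
  then obtain A where
    A: "\<forall>i. (A (Suc i), A i) \<in> {(A, B). closedin T A \<and> closedin T B \<and> A \<subset> B}" ..
  have chain: "closedin T (A i)" "A (Suc i) \<subset> A i" for i using A by simp_all
  have anti: "A j \<subseteq> A i" if "i \<le> j" for i j
    by (rule lift_Suc_antimono_le[of A, OF psubset_imp_subset[OF chain(2)] that])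
  define U where "U i = topspace T - A i" for i
  have "compactin T (\<Union>(range U))"
    using assms by (auto simp: noetherian_space_def U_def)
  moreover have "\<forall>V\<in>range U. openin T V" using chain(1) by (auto simp: U_def)
  ultimately have "\<exists>\<F>. finite \<F> \<and> \<F> \<subseteq> range U \<and> \<Union>(range U) \<subseteq> \<Union>\<F>"
    unfolding compactin_def by blast
  then obtain I where I: "finite I" "\<Union>(range U) \<subseteq> \<Union>(U ` I)" by (metis finite_subset_image)
  obtain n where n: "\<And>i. i \<in> I \<Longrightarrow> i \<le> n" using I(1) finite_nat_set_iff_bounded_le by auto
  have "U (Suc n) \<subseteq> U n" using I(2) n anti unfolding U_def by blast
  then have "A n \<subseteq> A (Suc n)" using chain(1)[of n] by (auto simp: U_def dest: closedin_subset)
  then show False using chain(2)[of n] by blast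
qed

lemma irreducible_in_subtopology:
  "irreducible_in (subtopology T Y) Z \<longleftrightarrow> Z \<subseteq> Y \<and> irreducible_in T Z"
proof -
  have "subtopology (subtopology T Y) Z = subtopology T Z" if "Z \<subseteq> Y"
    using that by (simp add: subtopology_subtopology Int_absorb1)
  then show ?thesis by (auto simp: irreducible_in_def)
qed

lemma irreducible_in_singleton: "x \<in> topspace T \<Longrightarrow> irreducible_in T {x}"
  by (auto simp: irreducible_in_def irreducible_space_def)

lemma irreducible_in_continuous_image:
  assumes Z: "irreducible_in T Z" and f: "continuous_map T T' f"
  shows "irreducible_in T' (f ` Z)"
proof -
  have sub: "Z \<subseteq> topspace T" using Z by (simp add: irreducible_in_def)
  then have fsub: "f ` Z \<subseteq> topspace T'" using f by (auto simp: continuous_map_def)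
  have fZ: "continuous_map (subtopology T Z) (subtopology T' (f ` Z)) f"
    using f by (auto simp: continuous_map_in_subtopology continuous_map_from_subtopology)
  have top: "topspace (subtopology T Z) = Z" "topspace (subtopology T' (f ` Z)) = f ` Z"
    using sub fsub by auto
  have "A = f ` Z \<or> B = f ` Z"
    if AB: "closedin (subtopology T' (f ` Z)) A" "closedin (subtopology T' (f ` Z)) B"
      "A \<union> B = f ` Z" for A B
  proof -
    have "closedin (subtopology T Z) {x \<in> Z. f x \<in> A}" "closedin (subtopology T Z) {x \<in> Z. f x \<in> B}"
      using closedin_continuous_map_preimage[OF fZ] AB(1,2) unfolding top by auto
    moreover have "{x \<in> Z. f x \<in> A} \<union> {x \<in> Z. f x \<in> B} = Z" using AB(3) by auto
    ultimately have "{x \<in> Z. f x \<in> A} = Z \<or> {x \<in> Z. f x \<in> B} = Z"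
      using Z unfolding irreducible_in_def irreducible_space_def top by blast
    then show ?thesis using AB(3) by auto
  qed
  then show ?thesis
    using Z fsub top by (auto simp: irreducible_in_def irreducible_space_def)
qed

text \<open>
  Noetherian induction: a closed set that is neither empty nor irreducible is the union of two smaller
  closed sets.
\<close>

lemma noetherian_closed_finite_Union_irreducible:
  assumes T: "noetherian_space T" and "closedin T C"
  shows "\<exists>\<F>. finite \<F> \<and> (\<forall>Z\<in>\<F>. irreducible_in T Z) \<and> C = \<Union>\<F>"
  using \<open>closedin T C\<close>
proof (induction C rule: wf_induct_rule[OF noetherian_space_wf_closedin[OF T]])
  case (1 C)
  have top: "topspace (subtopology T C) = C" using closedin_subset[OF 1(2)] by auto
  consider "C = {}" | "irreducible_in T C" | "C \<noteq> {}" "\<not> irreducible_in T C" by blast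
  then show ?case
  proof cases
    case 1
    then show ?thesis by (intro exI[of _ "{}"]) auto
  next
    case 2
    then show ?thesis by (intro exI[of _ "{C}"]) auto
  next
    case 3
    have "\<not> irreducible_space (subtopology T C)"
      using 3(2) closedin_subset[OF 1(2)] by (simp add: irreducible_in_def)
    then obtain A B where AB: "closedin (subtopology T C) A" "closedin (subtopology T C) B"
      "A \<union> B = C" "A \<noteq> C" "B \<noteq> C"
      using 3(1) unfolding irreducible_space_def top by blast
    then have cl: "closedin T A" "closedin T B"
      using closedin_trans_full[OF _ 1(2)] by auto
    have "A \<subset> C" "B \<subset> C" using AB by auto
    then have "\<exists>\<F>. finite \<F> \<and> (\<forall>Z\<in>\<F>. irreducible_in T Z) \<and> A = \<Union>\<F>"
      "\<exists>\<F>. finite \<F> \<and> (\<forall>Z\<in>\<F>. irreducible_in T Z) \<and> B = \<Union>\<F>"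
      using 1(1)[of A] 1(1)[of B] 1(2) cl by simp_all
    then obtain \<F> \<G> where "finite \<F>" "\<forall>Z\<in>\<F>. irreducible_in T Z" "A = \<Union>\<F>"
      "finite \<G>" "\<forall>Z\<in>\<G>. irreducible_in T Z" "B = \<Union>\<G>"
      by (elim exE conjE)
    then show ?thesis using AB(3) by (intro exI[of _ "\<F> \<union> \<G>"]) auto
  qed
qed

text \<open>
  In a space with closed points, these are exactly the points of the zero-dimensional irreducible
  components of the subspace \<open>Y\<close>.
\<close>

definition point_components :: "'a topology \<Rightarrow> 'a set \<Rightarrow> 'a set" where
  "point_components T Y = {x. irreducible_component (subtopology T Y) {x}}"

lemma point_components_iff:
  "x \<in> point_components T Y \<longleftrightarrow>
    x \<in> topspace T \<and> x \<in> Y \<and> (\<forall>Z\<subseteq>Y. irreducible_in T Z \<and> x \<in> Z \<longrightarrow> Z = {x})"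
  unfolding point_components_def irreducible_component_def irreducible_in_subtopology
  using irreducible_in_singleton[of x T] by (auto simp: irreducible_in_def)

text \<open>
  A singleton component must be one of the finitely many irreducible sets whose union is the space.
\<close>

lemma finite_point_components:
  assumes "noetherian_space T"
  shows "finite (point_components T Y)"
proof -
  have "noetherian_space (subtopology T Y)" using assms by (rule noetherian_space_subtopology)
  from noetherian_closed_finite_Union_irreducible[OF this closedin_topspace]
  obtain \<F> where F: "finite \<F>" "\<forall>Z\<in>\<F>. irreducible_in (subtopology T Y) Z"
    "topspace (subtopology T Y) = \<Union>\<F>" by (elim exE conjE)
  have "(\<lambda>x. {x}) ` point_components T Y \<subseteq> \<F>"
  proof clarify
    fix x assume x: "x \<in> point_components T Y"
    then have "x \<in> \<Union>\<F>" unfolding F(3)[symmetric] by (simp add: point_components_iff)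
    then obtain Z where Z: "Z \<in> \<F>" "x \<in> Z" by blast
    then have "Z = {x}" using x F(2) unfolding point_components_iff irreducible_in_subtopology by blast
    then show "{x} \<in> \<F>" using Z by simp
  qed
  then have "finite ((\<lambda>x. {x}) ` point_components T Y)" using F(1) by (rule finite_subset)
  then show ?thesis by (rule finite_imageD) simp
qed

lemma point_components_antimono:
  "x \<in> point_components T Y \<Longrightarrow> Y' \<subseteq> Y \<Longrightarrow> x \<in> Y' \<Longrightarrow> x \<in> point_components T Y'"
  unfolding point_components_iff by (metis subset_trans)

lemma point_components_image:
  assumes g: "continuous_map T T g" "continuous_map T T g'"
    and inv: "\<And>y. y \<in> topspace T \<Longrightarrow> g' (g y) = y" "\<And>y. y \<in> topspace T \<Longrightarrow> g (g' y) = y"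
    and Y: "Y \<subseteq> topspace T" and x: "x \<in> point_components T Y"
  shows "g x \<in> point_components T (g ` Y)"
proof -
  have xT: "x \<in> topspace T" "x \<in> Y" using x by (auto simp: point_components_iff)
  have "Z = {g x}" if Z: "Z \<subseteq> g ` Y" "irreducible_in T Z" "g x \<in> Z" for Z
  proof -
    have ZT: "Z \<subseteq> topspace T" using Z(2) by (simp add: irreducible_in_def)
    have "irreducible_in T (g' ` Z)" using Z(2) g(2) by (rule irreducible_in_continuous_image)
    moreover have "g' ` Z \<subseteq> Y" using Z(1) inv(1) Y by (auto simp: subset_iff)
    moreover have "x \<in> g' ` Z" using Z(3) inv(1)[OF xT(1)] by force
    ultimately have "g' ` Z = {x}" using x by (simp add: point_components_iff)
    then have "g ` g' ` Z = {g x}" by simp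
    moreover have "g ` g' ` Z = Z" using inv(2) ZT by (force simp: image_image)
    ultimately show ?thesis by simp
  qed
  moreover have "g x \<in> topspace T" using g(1) xT by (auto simp: continuous_map_def)
  ultimately show ?thesis using xT by (auto simp: point_components_iff)
qed

text \<open>
  If the component had a second point, the closed point \<open>x\<close> would start a chain of length one in it.
\<close>

lemma krull_dim_zero_component:
  assumes T1: "t1_space T" and Z: "irreducible_component (subtopology T Y) Z"
    and dim: "krull_dim (subtopology T Z) = 0" and x: "x \<in> Z"
  shows "x \<in> point_components T Y"
proof -
  have ZT: "irreducible_in T Z" "Z \<subseteq> topspace T" "Z \<subseteq> Y"
    using Z[unfolded irreducible_component_def irreducible_in_subtopology, THEN conjunct1]
    by (simp_all add: irreducible_in_def)
  have "Z = {x}"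
  proof (rule ccontr)
    assume neq: "Z \<noteq> {x}"
    define chain where "chain i = (if i = 0 then {x} else Z)" for i :: nat
    have cl: "closedin (subtopology T Z) (chain i)" "irreducible_in (subtopology T Z) (chain i)" for i
    proof -
      have "closedin T {x}" using T1 x ZT(2) by (auto simp: t1_space_closedin_singleton)
      then have "closedin (subtopology T Z) {x}" using x by (simp add: closedin_subset_topspace)
      moreover have "closedin (subtopology T Z) Z"
        using closedin_topspace[of "subtopology T Z"] ZT(2) by (simp add: Int_absorb1)
      moreover have "irreducible_in T {x}" using x ZT(2) by (intro irreducible_in_singleton) auto
      ultimately show "closedin (subtopology T Z) (chain i)"
        "irreducible_in (subtopology T Z) (chain i)"
        using x ZT(1) by (simp_all add: chain_def irreducible_in_subtopology)
    qed
    have "\<forall>i<1. chain i \<subset> chain (Suc i)"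
      using x neq by (simp add: chain_def psubset_eq)
    with cl have "\<exists>W. (\<forall>i\<le>1. closedin (subtopology T Z) (W i) \<and> irreducible_in (subtopology T Z) (W i))
        \<and> (\<forall>i<(1::nat). W i \<subset> W (Suc i))" by (intro exI[of _ chain]) simp
    then have "enat 1 \<le> krull_dim (subtopology T Z)"
      unfolding krull_dim_def by (intro Sup_upper CollectI exI[of _ 1] conjI[OF refl])
    then show False using dim by (simp add: enat_0_iff)
  qed
  then show ?thesis using Z by (simp add: point_components_def)
qed

lemma krull_dim_singleton: "krull_dim (subtopology T {x}) = 0"
proof -
  have len: "n = 0" if "\<forall>i\<le>n. closedin (subtopology T {x}) (Z i) \<and> irreducible_in (subtopology T {x}) (Z i)"
    "\<forall>i<n. Z i \<subset> Z (Suc i)" for n and Z :: "nat \<Rightarrow> 'a set"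
  proof (rule ccontr)
    assume "n \<noteq> 0"
    then have "irreducible_in (subtopology T {x}) (Z 0)" "Z 0 \<subset> Z (Suc 0)"
      "irreducible_in (subtopology T {x}) (Z (Suc 0))" using that by auto
    then show False
      by (auto simp: irreducible_in_subtopology irreducible_in_def irreducible_space_def)
  qed
  have "{enat n | n. \<exists>Z. (\<forall>i\<le>n. closedin (subtopology T {x}) (Z i) \<and>
      irreducible_in (subtopology T {x}) (Z i)) \<and> (\<forall>i<n. Z i \<subset> Z (Suc i))} \<subseteq> {0}"
  proof clarify
    fix n and Z :: "nat \<Rightarrow> 'a set"
    assume "\<forall>i\<le>n. closedin (subtopology T {x}) (Z i) \<and> irreducible_in (subtopology T {x}) (Z i)"
      "\<forall>i<n. Z i \<subset> Z (Suc i)"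
    then have "n = 0" by (rule len)
    then show "enat n = 0" by (simp add: enat_0_iff)
  qed
  from Sup_subset_mono[OF this] show ?thesis unfolding krull_dim_def by simp
qed

lemma t1_finite_point_components:
  assumes T1: "t1_space T" and Y: "finite Y" "Y \<subseteq> topspace T" "x \<in> Y"
  shows "x \<in> point_components T Y"
  unfolding point_components_iff
proof (intro conjI allI impI)
  fix Z assume Z: "Z \<subseteq> Y" "irreducible_in T Z \<and> x \<in> Z"
  have top: "topspace (subtopology T Z) = Z" using Z Y by auto
  have "closedin (subtopology T Z) S" if "S \<subseteq> Z" for S
  proof -
    have "closedin T S"
      using T1 Y Z that finite_subset[of S Y] by (auto simp: t1_space_closedin_finite)
    then show ?thesis using that by (auto simp: closedin_subset_topspace)
  qed
  then have "closedin (subtopology T Z) {x}" "closedin (subtopology T Z) (Z - {x})" using Z by auto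
  moreover have "{x} \<union> (Z - {x}) = Z" using Z by auto
  ultimately have "{x} = Z \<or> Z - {x} = Z"
    using Z(2) unfolding irreducible_in_def irreducible_space_def top by blast
  then show "Z = {x}" using Z by auto
qed (use Y in auto)

section \<open>The topology of polynomial functions\<close>

definition polynomial_open :: "nat \<Rightarrow> (nat \<Rightarrow> 'a::field) set \<Rightarrow> (nat \<Rightarrow> 'a) set \<Rightarrow> bool" where
  "polynomial_open n V W \<longleftrightarrow> W \<subseteq> V \<and>
    (\<forall>x\<in>W. \<exists>q\<in>polynomial_functions n. q x \<noteq> 0 \<and> (\<forall>y\<in>V. q y \<noteq> 0 \<longrightarrow> y \<in> W))"

text \<open>
  The topology whose closed subsets of \<open>V\<close> are the common zero sets of polynomial functions, here
  described through principal open neighbourhoods. The coefficients come from the field of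
  the coordinates itself, so for geometric points this is the geometric Zariski topology.
\<close>

definition polynomial_topology :: "nat \<Rightarrow> (nat \<Rightarrow> 'a::field) set \<Rightarrow> (nat \<Rightarrow> 'a) topology" where
  "polynomial_topology n V = topology (polynomial_open n V)"

context
  fixes n :: nat and R :: "((nat \<Rightarrow> 'a::field) \<Rightarrow> 'a) set"
  defines "R \<equiv> polynomial_functions n"
begin

interpretation R: subring_set R
  unfolding R_def using polynomial_functions_subring_noetherian by blast

lemma polynomial_functions_add:
  "f \<in> polynomial_functions n \<Longrightarrow> g \<in> polynomial_functions n \<Longrightarrow>
    (\<lambda>x::nat \<Rightarrow> 'a. f x + g x) \<in> polynomial_functions n"
  using R.add_closed[of f g] by (simp add: R_def plus_fun_def)

lemma polynomial_functions_mult: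
  "f \<in> polynomial_functions n \<Longrightarrow> g \<in> polynomial_functions n \<Longrightarrow>
    (\<lambda>x::nat \<Rightarrow> 'a. f x * g x) \<in> polynomial_functions n"
  using R.mult_closed[of f g] by (simp add: R_def times_fun_def)

end

lemma polynomial_functions_sum:
  "(\<And>i. i \<in> I \<Longrightarrow> f i \<in> polynomial_functions n) \<Longrightarrow>
    (\<lambda>x::nat \<Rightarrow> 'a::field. \<Sum>i\<in>I. f i x) \<in> polynomial_functions n"
  by (induction I rule: infinite_finite_induct)
     (auto intro: const_in_polynomial_functions polynomial_functions_add)

lemma polynomial_functions_prod:
  "(\<And>i. i \<in> I \<Longrightarrow> f i \<in> polynomial_functions n) \<Longrightarrow>
    (\<lambda>x::nat \<Rightarrow> 'a::field. \<Prod>i\<in>I. f i x) \<in> polynomial_functions n"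
  by (induction I rule: infinite_finite_induct)
     (auto intro: const_in_polynomial_functions polynomial_functions_mult)

lemma polynomial_functions_power:
  "f \<in> polynomial_functions n \<Longrightarrow> (\<lambda>x::nat \<Rightarrow> 'a::field. f x ^ k) \<in> polynomial_functions n"
  by (induction k) (auto intro: const_in_polynomial_functions polynomial_functions_mult)

lemma peval_polynomial_function:
  "p \<in> mpolys n \<Longrightarrow> peval p \<in> polynomial_functions n"
  unfolding peval_def mpolys_def
  by (auto intro!: polynomial_functions_sum polynomial_functions_mult const_in_polynomial_functions
      polynomial_functions_prod polynomial_functions_power coordinate_in_polynomial_functions)

lemma istopology_polynomial_open: "istopology (polynomial_open n V)"
  unfolding istopology_def
proof (intro conjI allI impI)
  fix S T assume S: "polynomial_open n V S" and T: "polynomial_open n V T"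
  have "\<exists>q\<in>polynomial_functions n. q x \<noteq> 0 \<and> (\<forall>y\<in>V. q y \<noteq> 0 \<longrightarrow> y \<in> S \<inter> T)"
    if x: "x \<in> S \<inter> T" for x
  proof -
    obtain p where p: "p \<in> polynomial_functions n" "p x \<noteq> 0" "\<forall>y\<in>V. p y \<noteq> 0 \<longrightarrow> y \<in> S"
      using S x unfolding polynomial_open_def by blast
    obtain q where q: "q \<in> polynomial_functions n" "q x \<noteq> 0" "\<forall>y\<in>V. q y \<noteq> 0 \<longrightarrow> y \<in> T"
      using T x unfolding polynomial_open_def by blast
    show ?thesis
      using polynomial_functions_mult[OF p(1) q(1)] p q by (intro bexI[of _ "\<lambda>x. p x * q x"]) auto
  qed
  then show "polynomial_open n V (S \<inter> T)"
    using S unfolding polynomial_open_def by blast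
next
  fix \<K> assume "\<forall>K\<in>\<K>. polynomial_open n V K"
  then show "polynomial_open n V (\<Union>\<K>)"
    unfolding polynomial_open_def by (metis Union_iff Union_least)
qed

lemma openin_polynomial_topology: "openin (polynomial_topology n V) = polynomial_open n V"
  unfolding polynomial_topology_def using istopology_polynomial_open by (rule topology_inverse')

lemma topspace_polynomial_topology: "topspace (polynomial_topology n V) = V"
proof -
  have "polynomial_open n V V"
    unfolding polynomial_open_def
    using const_in_polynomial_functions[of 1 n] by (auto intro!: bexI[of _ "\<lambda>x. 1"])
  then show ?thesis
    unfolding topspace_def openin_polynomial_topology polynomial_open_def by blast
qed

text \<open>
  Given a cover, collect the polynomial functions whose non-vanishing locus lies in some member of
  it. Finitely many of them generate all the others, so wherever some of them is non-zero, one of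
  these finitely many is.
\<close>

theorem noetherian_polynomial_topology: "noetherian_space (polynomial_topology n V)"
  unfolding noetherian_space_def compactin_def topspace_polynomial_topology openin_polynomial_topology
proof (intro allI impI conjI; (elim conjE)?)
  fix S \<U> assume SV: "S \<subseteq> V" and op: "\<forall>U\<in>\<U>. polynomial_open n V U" and cov: "S \<subseteq> \<Union>\<U>"
  define Q where
    "Q = {q \<in> polynomial_functions n. \<exists>U\<in>\<U>. \<forall>y\<in>V. q y \<noteq> 0 \<longrightarrow> y \<in> U}"
  have "\<exists>B\<subseteq>Q. finite B \<and> Q \<subseteq> ideal_span (polynomial_functions n) B"
    using polynomial_functions_subring_noetherian[of n, THEN conjunct2]
    unfolding noetherian_in_def by (rule allE[of _ Q]) (auto simp: Q_def)
  then obtain B where B: "B \<subseteq> Q" "finite B" "Q \<subseteq> ideal_span (polynomial_functions n) B"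
    by (elim exE conjE)
  have vanish: "f x = 0" if "f \<in> ideal_span (polynomial_functions n) B" "\<forall>b\<in>B. b x = 0" for f x
    using that by (induction rule: ideal_span.induct) auto
  have "\<forall>b\<in>B. \<exists>U\<in>\<U>. \<forall>y\<in>V. b y \<noteq> 0 \<longrightarrow> y \<in> U" using B(1) by (auto simp: Q_def)
  then obtain u where u: "\<And>b. b \<in> B \<Longrightarrow> u b \<in> \<U> \<and> (\<forall>y\<in>V. b y \<noteq> 0 \<longrightarrow> y \<in> u b)" by metis
  have "S \<subseteq> \<Union>(u ` B)"
  proof
    fix x assume x: "x \<in> S"
    then obtain U where U: "U \<in> \<U>" "x \<in> U" using cov by blast
    then obtain q where q: "q \<in> polynomial_functions n" "q x \<noteq> 0" "\<forall>y\<in>V. q y \<noteq> 0 \<longrightarrow> y \<in> U"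
      using op unfolding polynomial_open_def by blast
    then have "q \<in> Q" using U(1) unfolding Q_def by blast
    then obtain b where "b \<in> B" "b x \<noteq> 0" using vanish[of q x] B(3) q(2) by blast
    then show "x \<in> \<Union>(u ` B)" using u x SV by blast
  qed
  then show "\<exists>\<F>. finite \<F> \<and> \<F> \<subseteq> \<U> \<and> S \<subseteq> \<Union>\<F>"
    using B(2) u by (intro exI[of _ "u ` B"]) auto
qed

section \<open>The Zariski topology of a variety\<close>

lemma const_in_regular:
  assumes "function_sheaf \<X>" "openin (ktop \<X>) U"
  shows "(\<lambda>x\<in>U. to_ac c) \<in> regular \<X> U"
  using assms(1)[unfolded function_sheaf_def, THEN spec, THEN mp, OF assms(2),
      THEN conjunct2, THEN conjunct1] by (rule spec)

lemma restrict_in_regular: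
  assumes "function_sheaf \<X>" "openin (ktop \<X>) U" "s \<in> regular \<X> U" "openin (ktop \<X>) W" "W \<subseteq> U"
  shows "restrict s W \<in> regular \<X> W"
  using assms(1)[unfolded function_sheaf_def, THEN spec, THEN mp, OF assms(2),
      THEN conjunct2, THEN conjunct2, THEN conjunct2, THEN conjunct1,
      THEN bspec, OF assms(3), THEN spec, THEN mp] assms(4,5) by simp

lemma openin_zariski_nonvanishing:
  fixes r :: nat
  assumes "openin (ktop \<X>) U" "\<And>i. i < r \<Longrightarrow> f i \<in> regular \<X> U"
  shows "openin (zariski \<X>) {x \<in> U. (\<Sum>i<r. c i * f i x) \<noteq> 0}"
  unfolding zariski_def using assms by (intro topology_generated_by_Basis) blast

lemma openin_ktop_imp_zariski:
  fixes \<X> :: "('p, 'k::field) fspace"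
  assumes X: "function_sheaf \<X>" and U: "openin (ktop \<X>) U"
  shows "openin (zariski \<X>) U"
proof -
  have "openin (zariski \<X>) {x \<in> U. (\<Sum>i<1::nat. 1 * (\<lambda>x\<in>U. to_ac (1::'k)) x) \<noteq> 0}"
    by (rule openin_zariski_nonvanishing[OF U const_in_regular[OF X U]])
  moreover have "{x \<in> U. (\<Sum>i<1::nat. 1 * (\<lambda>x\<in>U. to_ac (1::'k)) x) \<noteq> 0} = U" by auto
  ultimately show ?thesis by simp
qed

lemma topspace_zariski:
  assumes "function_sheaf \<X>"
  shows "topspace (zariski \<X>) = points \<X>"
proof
  show "topspace (zariski \<X>) \<subseteq> points \<X>"
    unfolding zariski_def topology_generated_by_topspace by (auto dest: openin_subset)
  show "points \<X> \<subseteq> topspace (zariski \<X>)"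
    using openin_ktop_imp_zariski[OF assms openin_topspace] by (rule openin_subset)
qed

text \<open>
  Continuity is only to be checked on the non-vanishing loci that generate the topology.
\<close>

lemma continuous_map_zariskiI:
  assumes Y: "function_sheaf \<Y>" and f: "f \<in> topspace T \<rightarrow> points \<Y>"
    and op: "\<And>V (r::nat) c h. openin (ktop \<Y>) V \<Longrightarrow> (\<And>i. i < r \<Longrightarrow> h i \<in> regular \<Y> V) \<Longrightarrow>
      openin T {x \<in> topspace T. f x \<in> V \<and> (\<Sum>i<r. c i * h i (f x)) \<noteq> 0}"
  shows "continuous_map T (zariski \<Y>) f"
  unfolding zariski_def
proof (rule continuous_on_generated_topo)
  let ?\<B> = "{{x \<in> U. (\<Sum>i<r. c i * f i x) \<noteq> 0} |U (r::nat) c f.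
      openin (ktop \<Y>) U \<and> (\<forall>i<r. f i \<in> regular \<Y> U)}"
  have "\<Union>?\<B> = points \<Y>" using topspace_zariski[OF Y] by (simp add: zariski_def)
  then show "f ` topspace T \<subseteq> \<Union>?\<B>" using f by auto
  fix W assume "W \<in> ?\<B>"
  then obtain V c h and r :: nat where W: "W = {x \<in> V. (\<Sum>i<r. c i * h i x) \<noteq> 0}"
    "openin (ktop \<Y>) V" "\<forall>i<r. h i \<in> regular \<Y> V" by (elim CollectE exE conjE)
  have "f -` W \<inter> topspace T = {x \<in> topspace T. f x \<in> V \<and> (\<Sum>i<r. c i * h i (f x)) \<noteq> 0}"
    unfolding W(1) by auto
  then show "openin T (f -` W \<inter> topspace T)" using op[OF W(2)] W(3) by simp
qed

lemma morphism_continuous_zariski: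
  assumes X: "function_sheaf \<X>" and Y: "function_sheaf \<Y>" and f: "morphism \<X> \<Y> f"
  shows "continuous_map (zariski \<X>) (zariski \<Y>) f"
proof (rule continuous_map_zariskiI[OF Y])
  have cont: "continuous_map (ktop \<X>) (ktop \<Y>) f" using f by (simp add: morphism_def)
  then show "f \<in> topspace (zariski \<X>) \<rightarrow> points \<Y>"
    by (auto simp: topspace_zariski[OF X] continuous_map_def)
  fix V c h and r :: nat
  assume V: "openin (ktop \<Y>) V" and h: "\<And>i. i < r \<Longrightarrow> h i \<in> regular \<Y> V"
  let ?U = "{x \<in> points \<X>. f x \<in> V}"
  have U: "openin (ktop \<X>) ?U" using cont V by (rule openin_continuous_map_preimage)
  have "openin (zariski \<X>) {x \<in> ?U. (\<Sum>i<r. c i * restrict (h i \<circ> f) ?U x) \<noteq> 0}"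
  proof (rule openin_zariski_nonvanishing[OF U])
    show "restrict (h i \<circ> f) ?U \<in> regular \<X> ?U" if "i < r" for i
      using f V h[OF that] unfolding morphism_def by blast
  qed
  moreover have "{x \<in> ?U. (\<Sum>i<r. c i * restrict (h i \<circ> f) ?U x) \<noteq> 0} =
      {x \<in> topspace (zariski \<X>). f x \<in> V \<and> (\<Sum>i<r. c i * h i (f x)) \<noteq> 0}"
    by (auto simp: topspace_zariski[OF X])
  ultimately show "openin (zariski \<X>)
      {x \<in> topspace (zariski \<X>). f x \<in> V \<and> (\<Sum>i<r. c i * h i (f x)) \<noteq> 0}" by simp
qed

lemma peval_one: "peval 1 x = 1"
  by (simp add: peval_def)

lemma one_in_mpolys: "1 \<in> mpolys n"
  by (auto simp: mpolys_def)

lemma peval_coordinate: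
  "peval (Poly_Mapping.single (Poly_Mapping.single i (Suc 0)) (1::'k::field)) x = x i"
  by (simp add: peval_def)

lemma coordinate_in_mpolys:
  "i < n \<Longrightarrow> Poly_Mapping.single (Poly_Mapping.single i (Suc 0)) c \<in> mpolys n"
  by (auto simp: mpolys_def)

lemma points_affine_fspace: "points (affine_fspace n S) = zero_locus n S"
proof -
  have "zero_locus n S = {x \<in> zero_locus n S. peval 1 x \<noteq> 0}"
    by (simp add: peval_one)
  then have "zero_locus n S \<in> {{x \<in> zero_locus n S. peval q x \<noteq> 0} |q. q \<in> mpolys n}"
    using one_in_mpolys[of n] by blast
  then show ?thesis by (auto simp: affine_fspace_def)
qed

lemma coordinate_regular:
  assumes "i < n"
  shows "(\<lambda>x\<in>zero_locus n S. x i) \<in> regular (affine_fspace n S) (zero_locus n S)"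
proof -
  have "\<exists>p\<in>mpolys n. \<exists>q\<in>mpolys n. peval q x \<noteq> 0 \<and>
      (\<forall>y\<in>zero_locus n S. peval q y \<noteq> 0 \<longrightarrow>
        y \<in> zero_locus n S \<and> (\<lambda>x\<in>zero_locus n S. x i) y = peval p y / peval q y)" for x
    by (rule bexI[OF _ coordinate_in_mpolys[OF assms, of 1]], rule bexI[OF _ one_in_mpolys])
       (auto simp: peval_one peval_coordinate)
  then show ?thesis by (simp add: affine_fspace_def)
qed

text \<open>
  Near each point a combination of regular functions is a single fraction of polynomial functions, on a
  principal neighbourhood. For \<open>r = 0\<close> the sum says nothing about \<open>U\<close>, and the neighbourhood found
  in the induction need not lie in \<open>U\<close>; this explains the guard \<open>0 < r\<close>.
\<close>

lemma regular_sum_fraction: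
  fixes r :: nat
  assumes h: "\<forall>i<r. h i \<in> regular (affine_fspace n S) U" and x: "x \<in> U"
  shows "\<exists>P\<in>polynomial_functions n. \<exists>Q\<in>polynomial_functions n. Q x \<noteq> 0 \<and>
    (\<forall>y\<in>zero_locus n S. Q y \<noteq> 0 \<longrightarrow> (0 < r \<longrightarrow> y \<in> U) \<and> (\<Sum>i<r. c i * h i y) = P y / Q y)"
  using h
proof (induction r)
  case 0
  show ?case
    by (rule bexI[OF _ const_in_polynomial_functions[of 0]],
        rule bexI[OF _ const_in_polynomial_functions[of 1]]) simp
next
  case (Suc r)
  have "\<forall>i<r. h i \<in> regular (affine_fspace n S) U" using Suc.prems by simp
  from Suc.IH[OF this]
  obtain P Q where PQ: "P \<in> polynomial_functions n" "Q \<in> polynomial_functions n" "Q x \<noteq> 0"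
    "\<forall>y\<in>zero_locus n S. Q y \<noteq> 0 \<longrightarrow> (0 < r \<longrightarrow> y \<in> U) \<and> (\<Sum>i<r. c i * h i y) = P y / Q y"
    by (elim bexE conjE)
  have "h r \<in> regular (affine_fspace n S) U" using Suc.prems by simp
  then have "\<exists>p\<in>mpolys n. \<exists>q\<in>mpolys n. peval q x \<noteq> 0 \<and>
      (\<forall>y\<in>zero_locus n S. peval q y \<noteq> 0 \<longrightarrow> y \<in> U \<and> h r y = peval p y / peval q y)"
    using x by (simp add: affine_fspace_def)
  then obtain p q where pq: "p \<in> mpolys n" "q \<in> mpolys n" "peval q x \<noteq> 0"
    "\<forall>y\<in>zero_locus n S. peval q y \<noteq> 0 \<longrightarrow> y \<in> U \<and> h r y = peval p y / peval q y"
    by (elim bexE conjE)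
  let ?P = "\<lambda>y. P y * peval q y + c r * (peval p y * Q y)" and ?Q = "\<lambda>y. Q y * peval q y"
  have P: "?P \<in> polynomial_functions n"
    by (intro polynomial_functions_add polynomial_functions_mult const_in_polynomial_functions
        peval_polynomial_function PQ pq)
  have Q: "?Q \<in> polynomial_functions n"
    by (intro polynomial_functions_mult peval_polynomial_function PQ pq)
  have "(\<Sum>i<Suc r. c i * h i y) = ?P y / ?Q y"
    if "y \<in> zero_locus n S" "?Q y \<noteq> 0" for y
    using PQ(4) pq(4) that by (simp add: field_simps)
  then have "?Q x \<noteq> 0 \<and> (\<forall>y\<in>zero_locus n S. ?Q y \<noteq> 0 \<longrightarrow>
      (0 < Suc r \<longrightarrow> y \<in> U) \<and> (\<Sum>i<Suc r. c i * h i y) = ?P y / ?Q y)"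
    using PQ(3) pq(3,4) by simp
  then show ?case by (rule bexI[OF bexI[OF _ Q] P])
qed

lemma polynomial_open_nonvanishing:
  fixes r :: nat
  assumes h: "\<forall>i<r. h i \<in> regular (affine_fspace n S) U" and U: "U \<subseteq> zero_locus n S"
  shows "polynomial_open n (zero_locus n S) {x \<in> U. (\<Sum>i<r. c i * h i x) \<noteq> 0}"
  unfolding polynomial_open_def
proof (intro conjI ballI)
  show "{x \<in> U. (\<Sum>i<r. c i * h i x) \<noteq> 0} \<subseteq> zero_locus n S" using U by auto
  fix x assume "x \<in> {x \<in> U. (\<Sum>i<r. c i * h i x) \<noteq> 0}"
  then have x: "x \<in> U" "(\<Sum>i<r. c i * h i x) \<noteq> 0" by auto
  \<comment> \<open>The empty sum vanishes, so the degenerate case cannot occur here.\<close>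
  then have r: "0 < r" by (cases r) auto
  obtain P Q where PQ: "P \<in> polynomial_functions n" "Q \<in> polynomial_functions n" "Q x \<noteq> 0"
    "\<forall>y\<in>zero_locus n S. Q y \<noteq> 0 \<longrightarrow> (0 < r \<longrightarrow> y \<in> U) \<and> (\<Sum>i<r. c i * h i y) = P y / Q y"
    using regular_sum_fraction[OF h x(1), of c] by (elim bexE conjE)
  have "(\<Sum>i<r. c i * h i x) = P x / Q x" using PQ(3,4) x(1) U by auto
  then have "P x \<noteq> 0" using x(2) by auto
  then show "\<exists>q\<in>polynomial_functions n. q x \<noteq> 0 \<and>
      (\<forall>y\<in>zero_locus n S. q y \<noteq> 0 \<longrightarrow> y \<in> {x \<in> U. (\<Sum>i<r. c i * h i x) \<noteq> 0})"
    using polynomial_functions_mult[OF PQ(1,2)] PQ(3,4) r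
    by (intro bexI[of _ "\<lambda>y. P y * Q y"]) auto
qed

lemma morphism_affine_continuous:
  assumes Y: "function_sheaf \<Y>" and f: "morphism (affine_fspace n S) \<Y> f"
  shows "continuous_map (polynomial_topology n (zero_locus n S)) (zariski \<Y>) f"
proof (rule continuous_map_zariskiI[OF Y])
  let ?A = "affine_fspace n S"
  have cont: "continuous_map (ktop ?A) (ktop \<Y>) f" using f by (simp add: morphism_def)
  then show "f \<in> topspace (polynomial_topology n (zero_locus n S)) \<rightarrow> points \<Y>"
    by (auto simp: topspace_polynomial_topology continuous_map_def points_affine_fspace)
  fix V c h and r :: nat
  assume V: "openin (ktop \<Y>) V" and h: "\<And>i. i < r \<Longrightarrow> h i \<in> regular \<Y> V"
  let ?U = "{x \<in> points ?A. f x \<in> V}"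
  have "polynomial_open n (zero_locus n S) {x \<in> ?U. (\<Sum>i<r. c i * restrict (h i \<circ> f) ?U x) \<noteq> 0}"
  proof (rule polynomial_open_nonvanishing)
    show "\<forall>i<r. restrict (h i \<circ> f) ?U \<in> regular ?A ?U"
      using f V h unfolding morphism_def by blast
  qed (auto simp: points_affine_fspace)
  moreover have "{x \<in> ?U. (\<Sum>i<r. c i * restrict (h i \<circ> f) ?U x) \<noteq> 0} =
      {x \<in> zero_locus n S. f x \<in> V \<and> (\<Sum>i<r. c i * h i (f x)) \<noteq> 0}"
    by (auto simp: points_affine_fspace)
  ultimately show "openin (polynomial_topology n (zero_locus n S))
      {x \<in> topspace (polynomial_topology n (zero_locus n S)). f x \<in> V \<and> (\<Sum>i<r. c i * h i (f x)) \<noteq> 0}"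
    by (simp add: openin_polynomial_topology topspace_polynomial_topology)
qed

lemma morphism_open_subspace_imp_morphism:
  assumes X: "function_sheaf \<X>" and U: "openin (ktop \<X>) U"
    and f: "morphism \<A> (open_subspace \<X> U) f"
  shows "morphism \<A> \<X> f"
  unfolding morphism_def
proof (intro conjI allI impI ballI)
  have cont: "continuous_map (ktop \<A>) (subtopology (ktop \<X>) U) f"
    using f by (simp add: morphism_def open_subspace_def)
  then show "continuous_map (ktop \<A>) (ktop \<X>) f"
    by (rule continuous_map_into_fulltopology)
  fix V s assume V: "openin (ktop \<X>) V" and s: "s \<in> regular \<X> V"
  have VU: "openin (ktop \<X>) (V \<inter> U)" using V U by (rule openin_Int)
  have fU: "f x \<in> U" if "x \<in> points \<A>" for x
    using cont that by (auto simp: continuous_map_def)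
  have pullback: "restrict (t \<circ> f) {x \<in> points \<A>. f x \<in> W} \<in> regular \<A> {x \<in> points \<A>. f x \<in> W}"
    if "openin (subtopology (ktop \<X>) U) W" "t \<in> regular \<X> W" for W t
    using f that by (simp add: morphism_def open_subspace_def)
  have "restrict s (V \<inter> U) \<in> regular \<X> (V \<inter> U)"
    using restrict_in_regular[OF X V s VU] by simp
  with openin_subtopology_Int[OF V]
  have "restrict (restrict s (V \<inter> U) \<circ> f) {x \<in> points \<A>. f x \<in> V \<inter> U}
      \<in> regular \<A> {x \<in> points \<A>. f x \<in> V \<inter> U}"
    by (rule pullback)
  moreover have eq: "{x \<in> points \<A>. f x \<in> V \<inter> U} = {x \<in> points \<A>. f x \<in> V}" using fU by auto
  moreover have "restrict (restrict s (V \<inter> U) \<circ> f) {x \<in> points \<A>. f x \<in> V} =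
      restrict (s \<circ> f) {x \<in> points \<A>. f x \<in> V}"
    using fU by (auto simp: restrict_def fun_eq_iff)
  ultimately show "restrict (s \<circ> f) {x \<in> points \<A>. f x \<in> V} \<in> regular \<A> {x \<in> points \<A>. f x \<in> V}"
    by simp
qed

lemma affine_variety_chart:
  assumes "affine_variety (open_subspace \<X> U)" "openin (ktop \<X>) U"
  obtains n S \<psi> where "bij_betw \<psi> U (zero_locus n S)"
    "morphism (open_subspace \<X> U) (affine_fspace n S) \<psi>"
    "morphism (affine_fspace n S) (open_subspace \<X> U) (inv_into U \<psi>)"
proof -
  have "points (open_subspace \<X> U) = U"
    using openin_subset[OF assms(2)] by (auto simp: open_subspace_def)
  then show ?thesis
    using assms(1) unfolding affine_variety_def isomorphic_def points_affine_fspace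
    by (elim exE conjE, intro that) simp_all
qed

text \<open>
  Every affine piece is a continuous image of a zero locus with its polynomial topology, and finitely
  many such pieces cover the variety.
\<close>

theorem noetherian_zariski:
  assumes "variety \<X>"
  shows "noetherian_space (zariski \<X>)"
  unfolding noetherian_space_def
proof (intro allI impI)
  fix A assume A: "A \<subseteq> topspace (zariski \<X>)"
  have X: "function_sheaf \<X>" using assms by (simp add: variety_def)
  obtain \<U> where \<U>: "finite \<U>" "\<Union>\<U> = points \<X>"
    "\<forall>U\<in>\<U>. openin (ktop \<X>) U \<and> affine_variety (open_subspace \<X> U)"
    using assms unfolding variety_def by (elim conjE exE)
  have "compactin (zariski \<X>) (A \<inter> U)" if "U \<in> \<U>" for U
  proof -
    have U: "openin (ktop \<X>) U" "affine_variety (open_subspace \<X> U)" using \<U>(3) that by auto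
    obtain n S \<psi> where \<psi>: "bij_betw \<psi> U (zero_locus n S)"
      "morphism (affine_fspace n S) (open_subspace \<X> U) (inv_into U \<psi>)"
      using affine_variety_chart[OF U(2,1)] by metis
    have "continuous_map (polynomial_topology n (zero_locus n S)) (zariski \<X>) (inv_into U \<psi>)"
      using morphism_affine_continuous[OF X morphism_open_subspace_imp_morphism[OF X U(1) \<psi>(2)]] .
    with noetherian_polynomial_topology show ?thesis
    proof (rule compactin_continuous_image_noetherian)
      have "inv_into U \<psi> ` zero_locus n S = U"
        using bij_betw_inv_into[OF \<psi>(1)] by (simp add: bij_betw_def)
      then show "A \<inter> U \<subseteq> inv_into U \<psi> ` topspace (polynomial_topology n (zero_locus n S))"
        by (simp add: topspace_polynomial_topology)
    qed
  qed
  then have "compactin (zariski \<X>) (\<Union>U\<in>\<U>. A \<inter> U)"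
    using \<U>(1) by (intro compactin_Union) auto
  moreover have "(\<Union>U\<in>\<U>. A \<inter> U) = A" using A \<U>(2) topspace_zariski[OF X] by blast
  ultimately show "compactin (zariski \<X>) A" by simp
qed

text \<open>
  Two points of a common affine piece differ in some coordinate, which is a regular function
  defined over the ground field; subtracting its value at \<open>x\<close>, a constant of the algebraic
  closure, separates \<open>y\<close> from \<open>x\<close>. This is where the geometric topology is needed: in the topology over
  the ground field, conjugate points cannot be separated.
\<close>

theorem t1_zariski:
  fixes \<X> :: "('p, 'k::field) fspace"
  assumes "variety \<X>"
  shows "t1_space (zariski \<X>)"
  unfolding t1_space_def
proof (intro ballI impI)
  have X: "function_sheaf \<X>" using assms by (simp add: variety_def)
  fix y x assume "y \<in> topspace (zariski \<X>)" "x \<in> topspace (zariski \<X>)" and neq: "y \<noteq> x"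
  then have y: "y \<in> points \<X>" by (simp add: topspace_zariski[OF X])
  obtain \<U> where \<U>: "\<Union>\<U> = points \<X>"
    "\<forall>U\<in>\<U>. openin (ktop \<X>) U \<and> affine_variety (open_subspace \<X> U)"
    using assms unfolding variety_def by (elim conjE exE)
  obtain U where "U \<in> \<U>" "y \<in> U" using \<U>(1) y by blast
  then have U: "openin (ktop \<X>) U" "affine_variety (open_subspace \<X> U)" "y \<in> U" using \<U>(2) by auto
  show "\<exists>W. openin (zariski \<X>) W \<and> y \<in> W \<and> x \<notin> W"
  proof (cases "x \<in> U")
    case False
    then show ?thesis using openin_ktop_imp_zariski[OF X U(1)] U(3) by blast
  next
    case True
    obtain n S \<psi> where \<psi>: "bij_betw \<psi> U (zero_locus n S)"
      "morphism (open_subspace \<X> U) (affine_fspace n S) \<psi>"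
      using affine_variety_chart[OF U(2,1)] by metis
    have "\<psi> y \<noteq> \<psi> x" using \<psi>(1) True U(3) neq by (meson bij_betw_imp_inj_on inj_onD)
    then obtain i where i: "\<psi> y i \<noteq> \<psi> x i" by blast
    have "\<psi> y \<in> zero_locus n S" "\<psi> x \<in> zero_locus n S"
      using \<psi>(1) True U(3) by (auto dest: bij_betw_apply)
    then have "i < n" using i by (auto simp: zero_locus_def) (metis not_less)
    have pts: "points (open_subspace \<X> U) = U"
      using openin_subset[OF U(1)] by (auto simp: open_subspace_def)
    define s where "s = restrict ((\<lambda>x\<in>zero_locus n S. x i) \<circ> \<psi>) U"
    have U_eq: "{z \<in> U. \<psi> z \<in> zero_locus n S} = U" using \<psi>(1) by (auto dest: bij_betw_apply)
    have "openin (ktop (affine_fspace n S)) (zero_locus n S)"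
      using openin_topspace[of "ktop (affine_fspace n S)"] by (simp only: points_affine_fspace)
    then have "s \<in> regular (open_subspace \<X> U) U"
      using \<psi>(2)[unfolded morphism_def, THEN conjunct2, rule_format,
          OF _ coordinate_regular[OF \<open>i < n\<close>, of S]] pts U_eq
      by (simp add: s_def)
    then have s: "s \<in> regular \<X> U" by (simp add: open_subspace_def)
    have s_eq: "s z = \<psi> z i" if "z \<in> U" for z
      using that \<psi>(1) by (auto simp: s_def dest: bij_betw_apply)
    \<comment> \<open>The function \<open>s - s(x)\<close>, written as a linear combination of regular functions over the ground field.\<close>
    define h where "h j = (if j = 0 then s else (\<lambda>x\<in>U. to_ac 1))" for j :: nat
    define c where "c j = (if j = 0 then 1 else - \<psi> x i)" for j :: nat
    let ?W = "{z \<in> U. (\<Sum>j<2. c j * h j z) \<noteq> 0}"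
    have "openin (zariski \<X>) ?W"
      using s const_in_regular[OF X U(1), of 1] by (intro openin_zariski_nonvanishing U) (simp add: h_def)
    moreover have "(\<Sum>j<2. c j * h j z) = \<psi> z i - \<psi> x i" if "z \<in> U" for z
      using that s_eq by (simp add: c_def h_def numeral_2_eq_2)
    then have "y \<in> ?W" "x \<notin> ?W" using True U(3) i by auto
    ultimately show ?thesis by blast
  qed
qed

section \<open>Lower central series\<close>

context group
begin

definition commutator :: "'a \<Rightarrow> 'a \<Rightarrow> 'a" where
  "commutator g y = g \<otimes> y \<otimes> inv g \<otimes> inv y"

lemma inv_mult_cancel:
  assumes "x \<in> carrier G" "y \<in> carrier G"
  shows "inv x \<otimes> (x \<otimes> y) = y" "x \<otimes> (inv x \<otimes> y) = y"
  using assms by (simp_all add: m_assoc[symmetric])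

lemma commutator_closed [simp, intro]:
  "g \<in> carrier G \<Longrightarrow> y \<in> carrier G \<Longrightarrow> commutator g y \<in> carrier G"
  by (simp add: commutator_def)

lemma commutator_mult_left:
  assumes "g \<in> carrier G" "h \<in> carrier G" "y \<in> carrier G"
  shows "commutator (g \<otimes> h) y = (g \<otimes> commutator h y \<otimes> inv g) \<otimes> commutator g y"
  using assms by (simp add: commutator_def m_assoc inv_mult_group inv_mult_cancel)

lemma commutator_mult_right:
  assumes "g \<in> carrier G" "y \<in> carrier G" "z \<in> carrier G"
  shows "commutator g (y \<otimes> z) = commutator g y \<otimes> (y \<otimes> commutator g z \<otimes> inv y)"
  using assms by (simp add: commutator_def m_assoc inv_mult_group inv_mult_cancel)

lemma commutator_inv:
  assumes "g \<in> carrier G" "y \<in> carrier G"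
  shows "inv (commutator g y) = commutator y g"
  using assms by (simp add: commutator_def m_assoc inv_mult_group)

lemma commutator_inv_left:
  assumes "g \<in> carrier G" "y \<in> carrier G"
  shows "commutator (inv g) y = inv g \<otimes> inv (commutator g y) \<otimes> inv (inv g)"
  using assms by (simp add: commutator_def m_assoc inv_mult_group inv_mult_cancel)

lemma commutator_inv_right:
  assumes "g \<in> carrier G" "y \<in> carrier G"
  shows "commutator g (inv y) = inv y \<otimes> inv (commutator g y) \<otimes> inv (inv y)"
  using assms by (simp add: commutator_def m_assoc inv_mult_group inv_mult_cancel)

lemma conj_eq_commutator_mult:
  assumes "g \<in> carrier G" "y \<in> carrier G"
  shows "g \<otimes> y \<otimes> inv g = commutator g y \<otimes> y"
  using assms by (simp add: commutator_def m_assoc)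

text \<open>
  Modulo a normal subgroup \<open>M\<close>, elements commuting with given ones form a subgroup, so it suffices to
  test commutators on generators.
\<close>

lemma commutator_generate_in_normal:
  assumes M: "M \<lhd> G" and A: "A \<subseteq> carrier G" and B: "B \<subseteq> carrier G"
    and AB: "\<And>a b. a \<in> A \<Longrightarrow> b \<in> B \<Longrightarrow> commutator a b \<in> M"
    and g: "g \<in> generate G A" and y: "y \<in> generate G B"
  shows "commutator g y \<in> M"
proof -
  interpret M: normal M G by (rule M)
  note conj = M.inv_op_closed2
  have gA: "commutator g b \<in> M" if b: "b \<in> B" for b
    using g
  proof (induction rule: generate.induct)
    case one
    then show ?case using b B by (auto simp: commutator_def)
  next
    case (incl h)
    then show ?case using b AB by simp
  next
    case (inv h)
    then have "h \<in> carrier G" "b \<in> carrier G" using A B b by auto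
    then show ?case using AB[OF inv b] conj[of "inv h"] by (simp add: commutator_inv_left)
  next
    case (eng h1 h2)
    then have "h1 \<in> carrier G" "h2 \<in> carrier G" "b \<in> carrier G"
      using A B b generate_in_carrier by blast+
    then show ?case using eng conj by (simp add: commutator_mult_left)
  qed
  have gc: "g \<in> carrier G" using g A generate_in_carrier by blast
  show ?thesis
    using y
  proof (induction rule: generate.induct)
    case one
    then show ?case using gc by (simp add: commutator_def)
  next
    case (incl h)
    then show ?case by (rule gA)
  next
    case (inv h)
    then have "h \<in> carrier G" using B by auto
    then show ?case using gA[OF inv] conj[of "inv h"] gc by (simp add: commutator_inv_right)
  next
    case (eng h1 h2)
    then have "h1 \<in> carrier G" "h2 \<in> carrier G"
      using B generate_in_carrier by blast+
    then show ?case using eng conj gc by (simp add: commutator_mult_right)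
  qed
qed

lemma lower_central_subgroup: "subgroup (lower_central G n) G"
proof (induction n)
  case 0
  then show ?case by (simp add: subgroup_self)
next
  case (Suc n)
  then have "lower_central G n \<subseteq> carrier G" by (rule subgroup.subset)
  then show ?case by (auto intro!: generate_is_subgroup)
qed

lemma lower_central_carrier: "y \<in> lower_central G n \<Longrightarrow> y \<in> carrier G"
  using lower_central_subgroup subgroup.mem_carrier by metis

lemma commutator_lower_central:
  "g \<in> carrier G \<Longrightarrow> y \<in> lower_central G n \<Longrightarrow> commutator g y \<in> lower_central G (Suc n)"
  by (auto simp: commutator_def intro!: generate.incl)

lemma lower_central_Suc_subset: "lower_central G (Suc n) \<subseteq> lower_central G n"
proof (induction n)
  case 0
  show ?case using subgroup.subset[OF lower_central_subgroup[of "Suc 0"]] by simp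
next
  case (Suc n)
  then show ?case
    unfolding lower_central.simps(2)[of G "Suc n"] lower_central.simps(2)[of G n]
    by (intro mono_generate) (auto simp del: lower_central.simps)
qed

text \<open>
  Modulo the term after next, commutators are multiplicative in both arguments, so the commutators of
  generators generate the next term. In the induction step, \<open>M\<close> is the subgroup that they generate
  together with the term after next.
\<close>

lemma lower_central_fg_mod_next:
  assumes "finite A" and A: "A \<subseteq> carrier G" and gen: "generate G A = carrier G"
  shows "\<exists>B. finite B \<and> B \<subseteq> lower_central G k \<and>
    generate G (B \<union> lower_central G (Suc k)) = lower_central G k"
proof (induction k)
  case 0
  have "carrier G \<subseteq> generate G (A \<union> lower_central G (Suc 0))"
    using gen mono_generate[of A "A \<union> lower_central G (Suc 0)"] by blast
  moreover have "generate G (A \<union> lower_central G (Suc 0)) \<subseteq> carrier G"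
    using A lower_central_carrier by (intro generate_incl) blast
  ultimately show ?case
    using assms by (intro exI[of _ A]) auto
next
  case (Suc k)
  then obtain B where B: "finite B" "B \<subseteq> lower_central G k"
    "generate G (B \<union> lower_central G (Suc k)) = lower_central G k" by blast
  define C where "C = (\<lambda>(a, b). commutator a b) ` (A \<times> B)"
  define M where "M = generate G (C \<union> lower_central G (Suc (Suc k)))"
  have C: "C \<subseteq> lower_central G (Suc k)"
    using commutator_lower_central[OF subsetD[OF A] subsetD[OF B(2)]]
    by (auto simp: C_def simp del: lower_central.simps)
  have sub: "C \<union> lower_central G (Suc (Suc k)) \<subseteq> lower_central G (Suc k)"
    using C lower_central_Suc_subset by blast
  then have subc: "C \<union> lower_central G (Suc (Suc k)) \<subseteq> carrier G"
    using lower_central_carrier by blast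
  have M_sub: "M \<subseteq> lower_central G (Suc k)"
    unfolding M_def using sub lower_central_subgroup by (rule generate_subgroup_incl)
  have M_subgroup: "subgroup M G"
    unfolding M_def using subc by (rule generate_is_subgroup)
  have next_M: "lower_central G (Suc (Suc k)) \<subseteq> M"
    by (auto simp: M_def simp del: lower_central.simps intro: generate.incl)
  \<comment> \<open>Between two consecutive terms of the series every subgroup is normal.\<close>
  have "M \<lhd> G"
  proof (rule normal_invI[OF M_subgroup])
    fix g y assume g: "g \<in> carrier G" and y: "y \<in> M"
    have "commutator g y \<in> M"
      using commutator_lower_central[of g y "Suc k"] g y M_sub next_M by blast
    then have "commutator g y \<otimes> y \<in> M" using y M_subgroup by (simp add: subgroup.m_closed)
    then show "g \<otimes> y \<otimes> inv g \<in> M"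
      using g y M_subgroup subgroup.mem_carrier[OF M_subgroup] by (simp add: conj_eq_commutator_mult)
  qed
  have AB: "commutator a b \<in> M" if "a \<in> A" "b \<in> B \<union> lower_central G (Suc k)" for a b
  proof (cases "b \<in> B")
    case True
    then show ?thesis using that by (auto simp: M_def C_def intro: generate.incl)
  next
    case False
    then show ?thesis using that A commutator_lower_central[of a b "Suc k"] next_M by blast
  qed
  have "B \<union> lower_central G (Suc k) \<subseteq> carrier G"
    using B(2) lower_central_carrier by blast
  then have "commutator g y \<in> M" if "g \<in> carrier G" "y \<in> lower_central G k" for g y
    using commutator_generate_in_normal[OF \<open>M \<lhd> G\<close> A _ AB] that gen B(3) by blast
  then have "lower_central G (Suc k) \<subseteq> M"
    unfolding lower_central.simps commutator_def
    using M_subgroup by (intro generate_subgroup_incl) auto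
  then have "M = lower_central G (Suc k)" using M_sub by blast
  moreover have "finite C" using B(1) assms(1) by (simp add: C_def)
  ultimately show ?case using C unfolding M_def by blast
qed

text \<open>
  Starting from the trivial term of the series and going up, finitely many generators are added at each step.
\<close>

lemma lower_central_fg:
  assumes "finite A" "A \<subseteq> carrier G" "generate G A = carrier G"
    and nil: "lower_central G c = {\<one>}" and "k \<le> c"
  shows "\<exists>B. finite B \<and> B \<subseteq> lower_central G k \<and> generate G B = lower_central G k"
  using \<open>k \<le> c\<close>
proof (induction k rule: inc_induct)
  case base
  have "generate G {} = {\<one>}" by (rule generate_empty)
  then show ?case using nil by auto
next
  case (step k)
  obtain B where B: "finite B" "B \<subseteq> lower_central G k"
    "generate G (B \<union> lower_central G (Suc k)) = lower_central G k"
    using lower_central_fg_mod_next[OF assms(1-3)] by blast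
  obtain B' where B': "finite B'" "B' \<subseteq> lower_central G (Suc k)"
    "generate G B' = lower_central G (Suc k)"
    using step.IH by blast
  have sub: "B \<union> B' \<subseteq> lower_central G k" using B(2) B'(2) lower_central_Suc_subset by blast
  then have subc: "B \<union> B' \<subseteq> carrier G" using lower_central_carrier by blast
  have "B \<union> lower_central G (Suc k) \<subseteq> generate G (B \<union> B')"
    using B'(3) mono_generate[of B' "B \<union> B'"] by (auto intro: generate.incl)
  then have "lower_central G k \<subseteq> generate G (B \<union> B')"
    using B(3) generate_subgroup_incl[OF _ generate_is_subgroup[OF subc]] by metis
  moreover have "generate G (B \<union> B') \<subseteq> lower_central G k"
    using sub lower_central_subgroup by (rule generate_subgroup_incl)
  ultimately show ?case using B(1) B'(1) sub by (intro exI[of _ "B \<union> B'"]) auto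
qed

end

section \<open>Finite orbits\<close>

context group_action
begin

lemma group_G: "group G"
  using group_hom group_hom.axioms(1) by blast

definition fixed_points :: "'a set \<Rightarrow> 'c set" where
  "fixed_points S = {y \<in> E. \<forall>g\<in>S. \<phi> g y = y}"

definition stab_in :: "'a set \<Rightarrow> 'c \<Rightarrow> 'a set" where
  "stab_in H p = {g \<in> H. \<phi> g p = p}"

definition orbit_under :: "'a set \<Rightarrow> 'c \<Rightarrow> 'c set" where
  "orbit_under H x = (\<lambda>g. \<phi> g x) ` H"

lemma act_one: "x \<in> E \<Longrightarrow> \<phi> \<one> x = x"
  using id_eq_one by (metis restrict_apply')

lemma act_closed: "g \<in> carrier G \<Longrightarrow> x \<in> E \<Longrightarrow> \<phi> g x \<in> E"
  using element_image by blast

lemma act_inv: "g \<in> carrier G \<Longrightarrow> x \<in> E \<Longrightarrow> \<phi> (inv g) (\<phi> g x) = x"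
  using orbit_sym_aux by blast

lemma act_inv': "g \<in> carrier G \<Longrightarrow> x \<in> E \<Longrightarrow> \<phi> g (\<phi> (inv g) x) = x"
  using act_inv[of "inv g" x] group.inv_closed[OF group_G] group.inv_inv[OF group_G] by simp

text \<open>
  A transitive action of the group generated by \<open>B\<close> on \<open>d\<close> points is determined, after numbering the
  points, by the permutations through which the finitely many generators act. This leaves finitely
  many possibilities for the action together with a base point, and they determine the
  stabilizer.
\<close>

lemma finite_stabilizers:
  assumes "finite B" and B: "B \<subseteq> carrier G" and PE: "P \<subseteq> E"
    and P: "\<And>p. p \<in> P \<Longrightarrow> finite (orbit_under (generate G B) p) \<and>
      card (orbit_under (generate G B) p) = d"
  shows "finite (stab_in (generate G B) ` P)"
proof -
  interpret group G by (rule group_G)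
  let ?H = "generate G B"
  let ?O = "orbit_under ?H"
  have Hc: "g \<in> carrier G" if "g \<in> ?H" for g using that B generate_in_carrier by blast
  have O_closed: "\<phi> g y \<in> ?O p" if "p \<in> E" "g \<in> ?H" "y \<in> ?O p" for p g y
    using that Hc unfolding orbit_under_def
    by (auto simp: composition_rule[symmetric] intro!: imageI generate.eng)
  have O_E: "?O p \<subseteq> E" if "p \<in> E" for p
    using that Hc act_closed by (auto simp: orbit_under_def)
  have O_refl: "p \<in> ?O p" if "p \<in> E" for p
    using that act_one generate.one[of G B] unfolding orbit_under_def by force
  have "\<forall>p\<in>P. \<exists>f. bij_betw f (?O p) {..<d}"
    using P ex_bij_betw_finite_nat by (metis atLeast0LessThan)
  then obtain e where e: "\<And>p. p \<in> P \<Longrightarrow> bij_betw (e p) (?O p) {..<d}" by metis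
  have inj: "e p y = e p z \<longleftrightarrow> y = z" if "p \<in> P" "y \<in> ?O p" "z \<in> ?O p" for p y z
    using e[OF that(1)] that(2,3) by (meson bij_betw_imp_inj_on inj_on_eq_iff)
  have e_less: "e p y < d" if "p \<in> P" "y \<in> ?O p" for p y
    using e[OF that(1)] that(2) by (auto simp: bij_betw_def)
  \<comment> \<open>The action of the generators on the orbit of \<open>p\<close>, transported to the numbers below \<open>d\<close>, and the
    number of \<open>p\<close> itself.\<close>
  define code where "code p =
      (\<lambda>b\<in>B. \<lambda>i\<in>{..<d}. e p (\<phi> b (inv_into (?O p) (e p) i)), e p p)" for p
  have code_act: "fst (code p) b (e p y) = e p (\<phi> b y)" if "p \<in> P" "b \<in> B" "y \<in> ?O p" for p b y
    using that e[OF that(1)] e_less[of p y] by (simp add: code_def bij_betw_inv_into_left)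
  have code_range: "code p \<in> (B \<rightarrow>\<^sub>E ({..<d} \<rightarrow>\<^sub>E {..<d})) \<times> {..<d}" if p: "p \<in> P" for p
  proof -
    have pE: "p \<in> E" using p PE by blast
    have "e p (\<phi> b (inv_into (?O p) (e p) i)) < d" if "b \<in> B" "i < d" for b i
    proof (rule e_less[OF p])
      have "inv_into (?O p) (e p) i \<in> ?O p"
        using e[OF p] that by (intro inv_into_into) (auto simp: bij_betw_def)
      then show "\<phi> b (inv_into (?O p) (e p) i) \<in> ?O p"
        using O_closed[OF pE] that by (simp add: generate.incl)
    qed
    then show ?thesis using e_less[OF p O_refl[OF pE]] by (auto simp: code_def)
  qed
  have same_stab: "stab_in ?H p = stab_in ?H q"
    if p: "p \<in> P" and q: "q \<in> P" and eq: "code p = code q" for p q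
  proof -
    have pE: "p \<in> E" and qE: "q \<in> E" using p q PE by auto
    have B_act: "e p (\<phi> b y) = e q (\<phi> b z)"
      if "b \<in> B" "y \<in> ?O p" "z \<in> ?O q" "e p y = e q z" for b y z
      using code_act[OF p that(1,2)] code_act[OF q that(1,3)] eq that(4) by simp
    \<comment> \<open>Matching the points with equal numbers is an equivariant bijection between the two orbits.\<close>
    have act: "e p (\<phi> g y) = e q (\<phi> g z)"
      if "g \<in> ?H" "y \<in> ?O p" "z \<in> ?O q" "e p y = e q z" for g y z
      using that
    proof (induction arbitrary: y z rule: generate.induct)
      case one
      then show ?case using act_one O_E[OF pE] O_E[OF qE] by (metis subsetD)
    next
      case (incl h)
      then show ?case using B_act by blast
    next
      case (inv h)
      have h: "h \<in> carrier G" using inv B by blast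
      have hH: "h \<in> ?H" "inv h \<in> ?H" using inv by (auto intro: generate.intros)
      have y': "\<phi> (inv h) y \<in> ?O p" and z': "\<phi> (inv h) z \<in> ?O q"
        using O_closed pE qE hH inv by auto
      obtain w where w: "w \<in> ?O q" "e q w = e p (\<phi> (inv h) y)"
        using e[OF q] e_less[OF p y'] by (metis bij_betw_imp_surj_on imageE lessThan_iff)
      have "e p y = e q (\<phi> h w)"
        using B_act[OF inv(1) y' w(1)] w(2) act_inv'[OF h] inv(2) O_E[OF pE]
        by (metis subsetD)
      then have "\<phi> h w = z"
        using inv inj[OF q] O_closed[OF qE hH(1) w(1)] by metis
      then have "w = \<phi> (inv h) z" using act_inv[OF h subsetD[OF O_E[OF qE] w(1)]] by simp
      then show ?case using w(2) by simp
    next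
      case (eng h1 h2)
      have "e p (\<phi> h2 y) = e q (\<phi> h2 z)" using eng by blast
      then have "e p (\<phi> h1 (\<phi> h2 y)) = e q (\<phi> h1 (\<phi> h2 z))"
        using eng.prems eng.hyps
        by (intro eng.IH(1) O_closed[OF pE] O_closed[OF qE])
      then show ?case
        using eng Hc O_E[OF pE] O_E[OF qE] by (simp add: composition_rule subset_iff)
    qed
    have "\<phi> g p = p \<longleftrightarrow> \<phi> g q = q" if g: "g \<in> ?H" for g
    proof -
      have "e p p = e q q" using eq by (simp add: code_def)
      then have "e p (\<phi> g p) = e q (\<phi> g q)" using act g O_refl pE qE by blast
      then show ?thesis
        using inj[OF p O_closed[OF pE g O_refl[OF pE]] O_refl[OF pE]]
          inj[OF q O_closed[OF qE g O_refl[OF qE]] O_refl[OF qE]] \<open>e p p = e q q\<close> by simp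
    qed
    then show ?thesis by (auto simp: stab_in_def)
  qed
  have "finite ((B \<rightarrow>\<^sub>E ({..<d} \<rightarrow>\<^sub>E {..<d})) \<times> {..<d})"
    using assms(1) by (intro finite_cartesian_product finite_PiE) auto
  then have "finite (code ` P)" using code_range by (meson finite_subset image_subsetI)
  moreover have "stab_in ?H ` P = (\<lambda>c. stab_in ?H (SOME p. p \<in> P \<and> code p = c)) ` (code ` P)"
  proof -
    have "stab_in ?H (SOME q. q \<in> P \<and> code q = code p) = stab_in ?H p" if "p \<in> P" for p
      using someI[of "\<lambda>q. q \<in> P \<and> code q = code p" p] that same_stab by blast
    then show ?thesis by (force simp: image_image)
  qed
  ultimately show ?thesis by simp
qed

end

text \<open>
  The properties of zero-dimensional components of sets of points that the group-theoretic argument uses.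
\<close>

locale finite_special_points = group_action +
  fixes special :: "'c set \<Rightarrow> 'c set"
  assumes special_finite: "Y \<subseteq> E \<Longrightarrow> finite (special Y)"
    and special_antimono: "Y \<subseteq> E \<Longrightarrow> x \<in> special Y \<Longrightarrow> Y' \<subseteq> Y \<Longrightarrow> x \<in> Y' \<Longrightarrow> x \<in> special Y'"
    and special_image: "g \<in> carrier G \<Longrightarrow> Y \<subseteq> E \<Longrightarrow> x \<in> special Y \<Longrightarrow> \<phi> g x \<in> special (\<phi> g ` Y)"
begin

text \<open>
  The induction step. Each \<open>a\<^sup>k x\<close> is special in the fixed-point set of its stabilizer in \<open>H\<close>, and only
  finitely many stabilizers occur; so the points \<open>a\<^sup>k x\<close> repeat.
\<close>

lemma finite_orbit_insert_normalizing:
  assumes "finite B" and B: "B \<subseteq> carrier G" and a: "a \<in> carrier G"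
    and norm: "\<And>y. y \<in> generate G B \<Longrightarrow> a \<otimes> y \<otimes> inv a \<in> generate G B"
    and norm': "\<And>y. y \<in> generate G B \<Longrightarrow> inv a \<otimes> y \<otimes> a \<in> generate G B"
    and x: "x \<in> E" and fin: "finite (orbit_under (generate G B) x)"
    and h: "h \<in> generate G B" "x \<in> special (fixed_points {h})" "\<phi> h x = x"
  shows "finite (orbit_under (generate G (insert a B)) x)"
proof -
  interpret group G by (rule group_G)
  let ?H = "generate G B"
  let ?O = "orbit_under ?H"
  have Hc: "g \<in> carrier G" if "g \<in> ?H" for g using that B generate_in_carrier by blast
  have ac: "a [^] (k::nat) \<in> carrier G" for k using a by simp
  have pow_norm: "a [^] k \<otimes> y \<otimes> inv (a [^] k) \<in> ?H \<and> inv (a [^] k) \<otimes> y \<otimes> a [^] k \<in> ?H"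
    if "y \<in> ?H" for k::nat and y
    using that
  proof (induction k arbitrary: y)
    case 0
    then show ?case using Hc by simp
  next
    case (Suc k)
    have "a [^] k \<otimes> (a \<otimes> y \<otimes> inv a) \<otimes> inv (a [^] k) \<in> ?H" using Suc norm by blast
    moreover have "inv a \<otimes> (inv (a [^] k) \<otimes> y \<otimes> a [^] k) \<otimes> a \<in> ?H" using Suc norm' by blast
    ultimately show ?case using Suc(2) Hc a ac by (simp add: inv_mult_group m_assoc)
  qed
  define p where "p k = \<phi> (a [^] k) x" for k :: nat
  have pE: "p k \<in> E" for k unfolding p_def using act_closed ac x by blast
  have conj_act: "\<phi> g (\<phi> (a [^] k) y) = \<phi> (a [^] k) (\<phi> (inv (a [^] k) \<otimes> g \<otimes> a [^] k) y)"
    if "g \<in> carrier G" "y \<in> E" for g y and k :: nat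
    using that ac[of k] by (simp add: composition_rule[symmetric] m_assoc inv_mult_cancel)
  have O_p: "?O (p k) = \<phi> (a [^] k) ` ?O x" for k
  proof
    show "?O (p k) \<subseteq> \<phi> (a [^] k) ` ?O x"
      using conj_act Hc x pow_norm unfolding orbit_under_def p_def by auto
    show "\<phi> (a [^] k) ` ?O x \<subseteq> ?O (p k)"
    proof clarify
      fix y assume "y \<in> ?O x"
      then obtain g where g: "g \<in> ?H" "y = \<phi> g x" by (auto simp: orbit_under_def)
      have "\<phi> (a [^] k) y = \<phi> (a [^] k \<otimes> g \<otimes> inv (a [^] k)) (p k)"
        using g Hc[OF g(1)] ac[of k] x unfolding p_def
        by (simp add: composition_rule[symmetric] m_assoc inv_mult_cancel)
      then show "\<phi> (a [^] k) y \<in> ?O (p k)"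
        using pow_norm[OF g(1)] unfolding orbit_under_def by blast
    qed
  qed
  have O_E: "?O x \<subseteq> E" using x Hc act_closed by (auto simp: orbit_under_def)
  have inj_a: "inj_on (\<phi> (a [^] k)) (?O x)" for k :: nat
    using inj_prop[OF ac] O_E by (rule inj_on_subset)
  have "finite (stab_in ?H ` range p)"
    using \<open>finite B\<close> B
  proof (rule finite_stabilizers[where d = "card (?O x)"])
    show "range p \<subseteq> E" using pE by auto
    show "finite (?O q) \<and> card (?O q) = card (?O x)" if "q \<in> range p" for q
      using that fin inj_a O_p by (auto simp: card_image)
  qed
  have special0: "x \<in> special (fixed_points (stab_in ?H x))"
  proof (rule special_antimono[OF _ h(2)])
    show "fixed_points (stab_in ?H x) \<subseteq> fixed_points {h}"
      using h by (auto simp: fixed_points_def stab_in_def)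
  qed (use x in \<open>auto simp: fixed_points_def stab_in_def\<close>)
  have special_p: "p k \<in> special (fixed_points (stab_in ?H (p k)))" for k
  proof (rule special_antimono)
    show "p k \<in> special (\<phi> (a [^] k) ` fixed_points (stab_in ?H x))"
      unfolding p_def using special_image[OF ac _ special0] by (auto simp: fixed_points_def)
    show "\<phi> (a [^] k) ` fixed_points (stab_in ?H x) \<subseteq> E"
      using act_closed ac by (auto simp: fixed_points_def)
    show "p k \<in> fixed_points (stab_in ?H (p k))"
      using pE by (auto simp: fixed_points_def stab_in_def)
    show "fixed_points (stab_in ?H (p k)) \<subseteq> \<phi> (a [^] k) ` fixed_points (stab_in ?H x)"
    proof
      fix z assume z: "z \<in> fixed_points (stab_in ?H (p k))"
      then have zE: "z \<in> E" by (simp add: fixed_points_def)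
      define y where "y = \<phi> (inv (a [^] k)) z"
      have yE: "y \<in> E" using act_closed[OF inv_closed[OF ac] zE] by (simp add: y_def)
      have "\<phi> s y = y" if s: "s \<in> ?H" "\<phi> s x = x" for s
      proof -
        define t where "t = a [^] k \<otimes> s \<otimes> inv (a [^] k)"
        have tc: "t \<in> carrier G" using Hc[OF s(1)] ac by (simp add: t_def)
        have "inv (a [^] k) \<otimes> t \<otimes> a [^] k = s"
          using Hc[OF s(1)] ac[of k] by (simp add: t_def m_assoc inv_mult_cancel)
        then have "\<phi> t (p k) = p k" unfolding p_def using conj_act[OF tc x, of k] s(2) by simp
        then have "t \<in> stab_in ?H (p k)" using pow_norm[OF s(1)] by (simp add: stab_in_def t_def)
        then have tz: "\<phi> t z = z" using z by (simp add: fixed_points_def)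
        have "\<phi> s y = \<phi> (inv (a [^] k)) (\<phi> t z)"
          using Hc[OF s(1)] ac[of k] zE
          by (simp add: y_def t_def composition_rule[symmetric] m_assoc inv_mult_cancel)
        then show ?thesis using tz by (simp add: y_def)
      qed
      then have "y \<in> fixed_points (stab_in ?H x)"
        using yE by (auto simp: fixed_points_def stab_in_def)
      moreover have "z = \<phi> (a [^] k) y" using act_inv'[OF ac zE] by (simp add: y_def)
      ultimately show "z \<in> \<phi> (a [^] k) ` fixed_points (stab_in ?H x)" by blast
    qed
  qed
  have "range p \<subseteq> (\<Union>S\<in>stab_in ?H ` range p. special (fixed_points S))" using special_p by blast
  moreover have "finite (\<Union>S\<in>stab_in ?H ` range p. special (fixed_points S))"
    using \<open>finite (stab_in ?H ` range p)\<close> special_finite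
    by (intro finite_UN_I) (auto simp: fixed_points_def)
  ultimately have "\<not> inj p" using finite_subset infinite_UNIV_nat finite_imageD by blast
  then obtain i j where ij: "i < j" "p i = p j" by (metis injI linorder_neqE_nat)
  define m where "m = j - i"
  have "0 < m" "i + m = j" using ij by (auto simp: m_def)
  have "\<phi> (a [^] i) (\<phi> (a [^] m) x) = \<phi> (a [^] i) x"
    using ij(2) \<open>i + m = j\<close> x ac a by (simp add: p_def composition_rule[symmetric] nat_pow_mult)
  then have am: "\<phi> (a [^] m) x = x"
    using inj_prop[OF ac[of i]] act_closed[OF ac x] x by (meson inj_onD)
  \<comment> \<open>With \<open>a\<^sup>m x = x\<close>, finitely many translates of \<open>Hx\<close> make up a set stable under \<open>H\<close> and \<open>a\<close>.\<close>
  define F where "F = (\<Union>k<m. ?O (p k))"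
  have F_fin: "finite F" unfolding F_def O_p using fin by blast
  have F_E: "F \<subseteq> E" unfolding F_def O_p using O_E act_closed[OF ac] by auto
  have a_F: "\<phi> a ` F \<subseteq> F"
  proof clarify
    fix y assume "y \<in> F"
    then obtain k z where k: "k < m" "z \<in> ?O x" "y = \<phi> (a [^] k) z"
      unfolding F_def O_p by blast
    have zE: "z \<in> E" using k O_E by blast
    have y: "\<phi> a y = \<phi> (a [^] Suc k) z"
      using k(3) composition_rule[OF zE a ac] nat_pow_Suc2[OF a] by simp
    show "\<phi> a y \<in> F"
    proof (cases "Suc k < m")
      case True
      then show ?thesis using y k unfolding F_def O_p by blast
    next
      case False
      then have "Suc k = m" using k by simp
      then have "\<phi> a y \<in> ?O (p m)" using y k unfolding O_p by blast
      then have "\<phi> a y \<in> ?O (p 0)" using am x act_one by (simp add: p_def)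
      then show ?thesis using \<open>0 < m\<close> unfolding F_def by blast
    qed
  qed
  have B_F: "\<phi> b ` F \<subseteq> F" if "b \<in> B" for b
  proof -
    have b: "b \<in> ?H" using that by (rule generate.incl)
    have "\<phi> b y \<in> ?O (p k)" if "y \<in> ?O (p k)" for y k
      using that b pE Hc unfolding orbit_under_def
      by (auto simp: composition_rule[symmetric] intro!: imageI generate.eng)
    then show ?thesis unfolding F_def by blast
  qed
  have gens_c: "insert a B \<subseteq> carrier G" using a B by blast
  \<comment> \<open>An injective self-map of a finite set is onto, which takes care of the inverses of generators.\<close>
  have gens_F: "\<phi> g ` F = F" if "g \<in> insert a B" for g
  proof (rule endo_inj_surj[OF F_fin])
    show "\<phi> g ` F \<subseteq> F" using that a_F B_F by blast
    show "inj_on (\<phi> g) F" by (rule inj_on_subset[OF inj_prop[OF subsetD[OF gens_c that]] F_E])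
  qed
  have "\<phi> g ` F = F" if "g \<in> generate G (insert a B)" for g
    using that
  proof (induction rule: generate.induct)
    case one
    then show ?case using act_one F_E by (auto simp: image_def subset_iff)
  next
    case (incl h)
    then show ?case by (rule gens_F)
  next
    case (inv h)
    then have "\<phi> (inv h) ` F = \<phi> (inv h) ` \<phi> h ` F" using gens_F by simp
    also have "\<dots> = (\<lambda>y. y) ` F"
      unfolding image_image using inv gens_c F_E act_inv by (intro image_cong) auto
    finally show ?case by simp
  next
    case (eng h1 h2)
    have "\<phi> (h1 \<otimes> h2) ` F = \<phi> h1 ` \<phi> h2 ` F"
      unfolding image_image using eng gens_c F_E generate_in_carrier[OF gens_c]
      by (intro image_cong) (auto intro!: composition_rule)
    then show ?case using eng by simp
  qed
  moreover have "x \<in> F"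
  proof -
    have "\<phi> \<one> (p 0) \<in> ?O (p 0)" unfolding orbit_under_def by (intro imageI generate.one)
    then have "x \<in> ?O (p 0)" using x act_one by (simp add: p_def)
    then show ?thesis using \<open>0 < m\<close> unfolding F_def by blast
  qed
  ultimately have "orbit_under (generate G (insert a B)) x \<subseteq> F"
    unfolding orbit_under_def by blast
  then show ?thesis using F_fin by (rule finite_subset)
qed

text \<open>
  The terms of the lower central series are added to \<open>h\<close> one after the other, from the trivial one up to
  the whole group, and within each term its finitely many generators one by one.
\<close>

theorem nilpotent_finite_orbit:
  assumes fg: "finitely_generated_group G" and nil: "nilpotent_group G"
    and h: "h \<in> carrier G" and x: "x \<in> special (fixed_points {h})" "x \<in> fixed_points {h}"
  shows "finite (orbit_under (carrier G) x)"
proof -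
  interpret group G by (rule group_G)
  let ?\<gamma> = "lower_central G"
  obtain A where A: "finite A" "A \<subseteq> carrier G" "generate G A = carrier G"
    using fg by (auto simp: finitely_generated_group_def)
  obtain c where c: "?\<gamma> c = {\<one>}" using nil by (auto simp: nilpotent_group_def)
  have xE: "x \<in> E" and hx: "\<phi> h x = x" using x(2) by (auto simp: fixed_points_def)
  have "finite (orbit_under (generate G (insert h (?\<gamma> k))) x)" if "k \<le> c" for k
    using that
  proof (induction k rule: inc_induct)
    case base
    have "generate G (insert h {\<one>}) \<subseteq> stabilizer G \<phi> x"
      using h hx stabilizer_subgroup[OF xE] act_one[OF xE]
      by (intro generate_subgroup_incl) (auto simp: stabilizer_def)
    then have "orbit_under (generate G (insert h {\<one>})) x \<subseteq> {x}"
      by (auto simp: orbit_under_def stabilizer_def)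
    then show ?case using c finite_subset by (metis finite.emptyI finite.insertI)
  next
    case (step k)
    obtain C where C: "finite C" "C \<subseteq> ?\<gamma> k" "generate G C = ?\<gamma> k"
      using lower_central_fg[OF A c, of k] step by auto
    obtain C' where C': "finite C'" "C' \<subseteq> ?\<gamma> (Suc k)" "generate G C' = ?\<gamma> (Suc k)"
      using lower_central_fg[OF A c, of "Suc k"] step by auto
    have "finite (orbit_under (generate G (F \<union> insert h C')) x)" if "finite F" "F \<subseteq> C" for F
      using that
    proof (induction F)
      case empty
      have "generate G (insert h C') \<subseteq> generate G (insert h (?\<gamma> (Suc k)))"
        using C'(2) by (intro mono_generate) blast
      then show ?case
        using step.IH unfolding orbit_under_def by (metis finite_subset image_mono sup_bot.left_neutral)
    next
      case (insert a F)
      let ?B = "F \<union> insert h C'"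
      have Bc: "?B \<subseteq> carrier G"
        using insert.prems C(2) C'(2) h lower_central_carrier by blast
      have a\<gamma>: "a \<in> ?\<gamma> k" using insert C by blast
      have a: "a \<in> carrier G" using a\<gamma> by (rule lower_central_carrier)
      have \<gamma>_sub: "?\<gamma> (Suc k) \<subseteq> generate G ?B"
        using C'(3) mono_generate[of C' ?B] by blast
      \<comment> \<open>\<open>b y b\<^sup>-\<^sup>1 = [b, y] y\<close>, and \<open>[b, y]\<close> lies in the next term, which is already included.\<close>
      have conj: "b \<otimes> y \<otimes> inv b \<in> generate G ?B" if "b \<in> ?\<gamma> k" "y \<in> generate G ?B" for b y
      proof -
        have b: "b \<in> carrier G" and y: "y \<in> carrier G"
          using that lower_central_carrier generate_in_carrier[OF Bc] by auto
        have "inv (commutator y b) \<in> ?\<gamma> (Suc k)"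
          using commutator_lower_central[OF y that(1)] lower_central_subgroup
          by (rule subgroup.m_inv_closed[rotated])
        then have "commutator b y \<in> generate G ?B"
          using \<gamma>_sub b y by (auto simp: commutator_inv)
        then show ?thesis using that(2) b y by (simp add: conj_eq_commutator_mult generate.eng)
      qed
      have "finite (orbit_under (generate G (insert a ?B)) x)"
      proof (rule finite_orbit_insert_normalizing[OF _ Bc a])
        show "finite ?B" using insert C' by simp
        show "a \<otimes> y \<otimes> inv a \<in> generate G ?B" if "y \<in> generate G ?B" for y
          using conj[OF a\<gamma> that] .
        show "inv a \<otimes> y \<otimes> a \<in> generate G ?B" if "y \<in> generate G ?B" for y
          using conj[OF subgroup.m_inv_closed[OF lower_central_subgroup a\<gamma>] that] a by simp
        show "finite (orbit_under (generate G ?B) x)" using insert by blast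
        show "h \<in> generate G ?B" by (rule generate.incl) simp
      qed (use x xE hx in auto)
      then show ?case by (simp add: insert_commute)
    qed
    from this[OF C(1) subset_refl]
    have fin: "finite (orbit_under (generate G (C \<union> insert h C')) x)" .
    have Bc: "C \<union> insert h C' \<subseteq> carrier G"
      using C(2) C'(2) h lower_central_carrier by blast
    have "generate G (insert h (?\<gamma> k)) \<subseteq> generate G (C \<union> insert h C')"
    proof (rule generate_subgroup_incl[OF _ generate_is_subgroup[OF Bc]])
      show "insert h (?\<gamma> k) \<subseteq> generate G (C \<union> insert h C')"
        using C(3) mono_generate[of C "C \<union> insert h C'"] by (auto intro: generate.incl)
    qed
    then show ?case using fin unfolding orbit_under_def by (meson finite_subset image_mono)
  qed
  from this[of 0] have "finite (orbit_under (generate G (insert h (carrier G))) x)" by simp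
  moreover have "carrier G \<subseteq> generate G (insert h (carrier G))" by (auto intro: generate.incl)
  ultimately show ?thesis unfolding orbit_under_def by (meson finite_subset image_mono)
qed

end

section \<open>Periodic points\<close>

lemma Per_n_star_imp_point_component:
  assumes "variety \<X>" "x \<in> Per_n_star \<X> n g"
  shows "x \<in> point_components (zariski \<X>) (Per_n \<X> n g)"
  using assms(2) krull_dim_zero_component[OF t1_zariski[OF assms(1)]]
  unfolding Per_n_star_def by blast

text \<open>
  A finite set of closed points is discrete, so each of its points is a component of dimension zero.
\<close>

lemma finite_Per_subset_Per_star:
  assumes X: "variety \<X>" and fin: "\<forall>n\<ge>1. finite (Per_n \<X> n g)"
  shows "Per \<X> g \<subseteq> Per_star \<X> g"
proof
  fix x assume "x \<in> Per \<X> g"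
  then have ex: "\<exists>n. 0 < n \<and> x \<in> Per_n \<X> n g" by (auto simp: Per_def Suc_le_eq)
  define n where "n = (LEAST n. 0 < n \<and> x \<in> Per_n \<X> n g)"
  have n: "0 < n" "x \<in> Per_n \<X> n g" using LeastI_ex[OF ex] by (auto simp: n_def)
  have least: "(g ^^ m) x \<noteq> x" if "0 < m" "m < n" for m
    using not_less_Least[of m "\<lambda>n. 0 < n \<and> x \<in> Per_n \<X> n g"] that n(2)
    by (auto simp: n_def Per_n_def)
  have "Per_n \<X> n g \<subseteq> topspace (zariski \<X>)"
    using X by (auto simp: variety_def topspace_zariski Per_n_def)
  then have "x \<in> point_components (zariski \<X>) (Per_n \<X> n g)"
    using fin[rule_format, of n] n by (intro t1_finite_point_components t1_zariski[OF X]) auto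
  then have "x \<in> Per_n_star \<X> n g"
    using n(2) least unfolding Per_n_star_def point_components_def
    by (auto intro!: exI[of _ "{x}"] krull_dim_singleton)
  then show "x \<in> Per_star \<X> g" using n(1) by (auto simp: Per_star_def)
qed

theorem theorem1p5:
  fixes \<X> :: "('p, 'k::field) fspace" and G :: "('p \<Rightarrow> 'p) set"
  assumes "variety \<X>"
    and "subgroup G (aut_group \<X>)"
    and "finitely_generated_group ((aut_group \<X>)\<lparr>carrier := G\<rparr>)"
    and "nilpotent_group ((aut_group \<X>)\<lparr>carrier := G\<rparr>)"
  shows "\<forall>g\<^sub>1\<in>G. \<forall>g\<^sub>2\<in>G.
    Per_star \<X> g\<^sub>1 \<subseteq> Per \<X> g\<^sub>2 \<and>
    ((\<forall>n\<ge>1. finite (Per_n \<X> n g\<^sub>1) \<and> finite (Per_n \<X> n g\<^sub>2)) \<longrightarrow> Per \<X> g\<^sub>1 = Per \<X> g\<^sub>2)"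
proof -
  let ?E = "points \<X>" and ?H = "(aut_group \<X>)\<lparr>carrier := G\<rparr>" and ?T = "zariski \<X>"
  have X: "function_sheaf \<X>" using assms(1) by (simp add: variety_def)
  have GAut: "G \<subseteq> {g \<in> Bij ?E. automorphism \<X> g}"
    using subgroup.subset[OF assms(2)] by (simp add: aut_group_def)
  have GBij: "G \<subseteq> Bij ?E" using GAut by blast
  have H: "group ?H" using assms(4) by (simp add: nilpotent_group_def)
  have mult: "g \<otimes>\<^bsub>?H\<^esub> h = compose ?E g h" if "g \<in> G" "h \<in> G" for g h
    using that GBij by (auto simp: aut_group_def BijGroup_def)
  have "(\<lambda>g. g) \<in> hom ?H (BijGroup ?E)"
    using GBij by (auto simp: hom_def aut_group_def BijGroup_def)
  then have "group_hom ?H (BijGroup ?E) (\<lambda>g. g)"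
    by (intro group_hom.intro group_hom_axioms.intro H group_BijGroup)
  then interpret act: group_action ?H ?E "\<lambda>g. g" by (rule group_action.intro)
  have special: "finite_special_points ?H ?E (\<lambda>g. g) (point_components ?T)"
  proof (intro finite_special_points.intro finite_special_points_axioms.intro act.group_action_axioms)
    show "finite (point_components ?T Y)" for Y
      using noetherian_zariski[OF assms(1)] by (rule finite_point_components)
    show "x \<in> point_components ?T Y'"
      if "x \<in> point_components ?T Y" "Y' \<subseteq> Y" "x \<in> Y'" for x Y Y'
      using that by (rule point_components_antimono)
    fix g Y x assume g: "g \<in> carrier ?H" and Y: "Y \<subseteq> ?E" and x: "x \<in> point_components ?T Y"
    have aut: "bij_betw g ?E ?E" "morphism \<X> \<X> g" "morphism \<X> \<X> (inv_into ?E g)"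
      using g GAut by (auto simp: automorphism_def)
    show "g x \<in> point_components ?T (g ` Y)"
    proof (rule point_components_image[where g' = "inv_into ?E g"])
      show "continuous_map ?T ?T g" "continuous_map ?T ?T (inv_into ?E g)"
        using morphism_continuous_zariski[OF X X] aut(2,3) by auto
      show "inv_into ?E g (g y) = y" if "y \<in> topspace ?T" for y
        using that aut(1) by (simp add: topspace_zariski[OF X] bij_betw_inv_into_left)
      show "g (inv_into ?E g y) = y" if "y \<in> topspace ?T" for y
        using that aut(1) by (simp add: topspace_zariski[OF X] bij_betw_inv_into_right)
      show "Y \<subseteq> topspace ?T" using Y by (simp add: topspace_zariski[OF X])
    qed (rule x)
  qed
  then interpret act: finite_special_points ?H ?E "\<lambda>g. g" "point_components ?T" .
  interpret H: group ?H by (rule H)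
  have pow: "\<exists>k\<in>G. \<forall>x\<in>?E. k x = (g ^^ n) x" if "g \<in> G" for g and n :: nat
  proof (induction n)
    case 0
    show ?case using act.act_one H.one_closed by (intro bexI[of _ "\<one>\<^bsub>?H\<^esub>"]) auto
  next
    case (Suc n)
    then obtain k where k: "k \<in> G" "\<forall>x\<in>?E. k x = (g ^^ n) x" by blast
    have "compose ?E g k \<in> G" using H.m_closed[of g k] k(1) that mult by simp
    then show ?case using k(2) by (intro bexI[of _ "compose ?E g k"]) (auto simp: compose_def)
  qed
  have star: "Per_star \<X> g\<^sub>1 \<subseteq> Per \<X> g\<^sub>2" if g: "g\<^sub>1 \<in> G" "g\<^sub>2 \<in> G" for g\<^sub>1 g\<^sub>2
  proof
    fix x assume "x \<in> Per_star \<X> g\<^sub>1"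
    then obtain n where n: "x \<in> Per_n_star \<X> n g\<^sub>1" by (auto simp: Per_star_def)
    obtain h where h: "h \<in> G" "\<forall>y\<in>?E. h y = (g\<^sub>1 ^^ n) y" using pow[OF g(1)] by blast
    have fix_h: "act.fixed_points {h} = Per_n \<X> n g\<^sub>1"
      using h(2) by (auto simp: act.fixed_points_def Per_n_def)
    have x: "x \<in> Per_n \<X> n g\<^sub>1" using n by (simp add: Per_n_star_def)
    have "finite (act.orbit_under G x)"
      using act.nilpotent_finite_orbit[OF assms(3,4), of h x]
        Per_n_star_imp_point_component[OF assms(1) n] h(1) x fix_h by simp
    moreover have "range (\<lambda>k. (g\<^sub>2 ^^ k) x) \<subseteq> act.orbit_under G x"
    proof clarify
      fix k
      obtain f where "f \<in> G" "\<forall>y\<in>?E. f y = (g\<^sub>2 ^^ k) y" using pow[OF g(2)] by blast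
      moreover have "x \<in> ?E" using x by (simp add: Per_n_def)
      ultimately have "(g\<^sub>2 ^^ k) x = f x" "f \<in> G" by auto
      then show "(g\<^sub>2 ^^ k) x \<in> act.orbit_under G x" by (auto simp: act.orbit_under_def)
    qed
    ultimately have "finite (range (\<lambda>k. (g\<^sub>2 ^^ k) x))" by (rule finite_subset[rotated])
    then have "\<not> inj (\<lambda>k. (g\<^sub>2 ^^ k) x)" using finite_imageD infinite_UNIV_nat by metis
    then obtain i j where ij: "i < j" "(g\<^sub>2 ^^ i) x = (g\<^sub>2 ^^ j) x"
      by (metis injI linorder_neqE_nat)
    have bij: "bij_betw g\<^sub>2 ?E ?E" using g(2) GBij by (auto simp: Bij_def)
    have xE: "x \<in> ?E" using x by (simp add: Per_n_def)
    have bij_pow: "bij_betw (g\<^sub>2 ^^ k) ?E ?E" for k using bij by (rule bij_betw_funpow)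
    have "(g\<^sub>2 ^^ i) ((g\<^sub>2 ^^ (j - i)) x) = (g\<^sub>2 ^^ i) x"
      using ij by (metis comp_apply funpow_add le_add_diff_inverse less_imp_le)
    then have "(g\<^sub>2 ^^ (j - i)) x = x"
      using bij_betw_imp_inj_on[OF bij_pow[of i]] bij_betw_apply[OF bij_pow xE] xE
      by (meson inj_onD)
    then show "x \<in> Per \<X> g\<^sub>2" using ij(1) xE by (auto simp: Per_def Per_n_def intro!: bexI[of _ "j - i"])
  qed
  have "Per \<X> g\<^sub>1 \<subseteq> Per \<X> g\<^sub>2" if "g\<^sub>1 \<in> G" "g\<^sub>2 \<in> G" "\<forall>n\<ge>1. finite (Per_n \<X> n g\<^sub>1)" for g\<^sub>1 g\<^sub>2
    using finite_Per_subset_Per_star[OF assms(1) that(3)] star[OF that(1,2)] by blast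
  then show ?thesis using star by blast
qed

end
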